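(* Let $(S,N,Z)$ be a structured semigroup. Then the canonical projection $\rho_\mathcal{C}:\widetilde{\mathcal{C}}(S)\rightarrow\mathcal{C}(S)$ is an étale bundle.
   Context: A structured semigroup $(S,N,Z)$ consists of a semigroup $S$, a subsemigroup $N$ of $S$ and a subsemigroup $Z$ of $S$ with $Z\subseteq\mathsf{Z}(N)=\{z\in N:\forall n\in N\ (nz=zn)\}$, such that: (i) for all $a,b\in S$, $ab,ba\in Z$ implies $aZb\cup bZa\subseteq Z$; (ii) for all $a,b\in S$ and $n\in N$, if $abn=n=nab$ and $ab,ba\in Z$ then $bna\in N$. For $a,s,b\in S$: $a<_sb$ means $asb=a=bsa$, $as,sa\in N$ and $bs,sb\in Z$; $a<b$ means $a<_sb$ for some $s\in S$. For $A,B\subseteq S$: $AB=\{ab:a\in A,b\in B\}$, $A^<=\{b\in S:\exists a\in A\ (a<b)\}$ and $A^*=\{s\in S:\exists a\in A\,\exists b\in S\ (a<_sb)\}$. An atlas is an $A\subseteq S$ with $AA^*A\subseteq A\subseteq A^<$; a coset is a $C\subseteq S$ with $CC^*C\subseteq C=C^<$. For an atlas $A$, $A^<$ is a coset; put $\mathsf{s}(A)=(A^*A)^<$, $\mathsf{r}(A)=(AA^* )^<$. $\mathcal{C}(S)$ is the set of non-empty cosets, an étale groupoid with inverse $C\mapsto C^*$, product $B\cdot C=(BC)^<$ defined when $\mathsf{s}(B)=\mathsf{r}(C)$, and the topology with subbasis $\mathcal{C}_a=\{C\in\mathcal{C}(S):a\in C\}$, $a\in S$. For an atlas $A$, $\sim_A$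 is the equivalence relation on $A^<$ given by $a\sim_Ab\Leftrightarrow\exists s,t\in A^*\ (sat=sbt)$. For $a\in A^<$, $[a,A]=(a^{\sim_A},A^<)$, where $a^{\sim_A}$ is the $\sim_A$-class of $a$. $\widetilde{\mathcal{C}}(S)=\{[c,C]:c\in C\in\mathcal{C}(S)\}$ is a groupoid under $[a,A][b,B]=[ab,AB]$ when $\mathsf{s}(A)=\mathsf{r}(B)$, with $[c,C]^{-1}=[c',C^*]$ for any $c'$ such that $d<_{c'}c$ for some $d\in C$. $\rho_\mathcal{C}([a,A])=A^<$. The topology on $\widetilde{\mathcal{C}}(S)$ is generated by the sets $\widetilde{\mathcal{C}}^s=\{[s,C]:s\in C\in\mathcal{C}(S)\}$ and $\widetilde{\mathcal{C}}_s=\{[c,C]:c,s\in C\in\mathcal{C}(S)\}=\rho_\mathcal{C}^{-1}[\mathcal{C}_s]$, for $s\in S$. A topological groupoid has continuous inverse and product; it is étale if its source map sends open subsets of the groupoid to open subsets of the groupoid (no Hausdorff assumptions). A groupoid bundle is a map $\pi:F\to G$ where $F$ is a topological groupoid, $G$ is an étale groupoid and $\pi$ is an open continuous isocofibration (a functor injective on units). An étale bundle is a groupoid bundle $\pi$ that is also locally injective: every point of $F$ has a neighbourhood on which $\pi$ is injective. *)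

theory Defs
  imports "HOL-Analysis.Analysis" "HOL-Library.Set_Algebras"
begin

section \<open>Topological groupoids and bundles\<close>

text \<open>
  Groupoids are given by their arrows only, units being particular arrows, with a product
  that is only meaningful on the pairs in \<open>composable\<close>.
\<close>

record 'g top_groupoid =
  arrows :: "'g set"
  composable :: "('g \<times> 'g) set"
  gmult :: "'g \<Rightarrow> 'g \<Rightarrow> 'g"
  ginv :: "'g \<Rightarrow> 'g"
  gtop :: "'g topology"

definition gsource :: "('g, 'z) top_groupoid_scheme \<Rightarrow> 'g \<Rightarrow> 'g" where
  "gsource G g = gmult G (ginv G g) g"

definition grange :: "('g, 'z) top_groupoid_scheme \<Rightarrow> 'g \<Rightarrow> 'g" where
  "grange G g = gmult G g (ginv G g)"

definition gunits :: "('g, 'z) top_groupoid_scheme \<Rightarrow> 'g set" where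
  "gunits G = gsource G ` arrows G"

text \<open>
  The usual axioms of a groupoid as a set of arrows with partial product and inverse (Hahn,
  Renault).  Such a structure is the same thing as a small category with all arrows invertible:
  see \<open>groupoid_composable_iff\<close> and \<open>groupoid_unit_laws\<close> below.
\<close>

definition groupoid :: "('g, 'z) top_groupoid_scheme \<Rightarrow> bool" where
  "groupoid G \<longleftrightarrow>
     composable G \<subseteq> arrows G \<times> arrows G \<and>
     (\<forall>g h. (g, h) \<in> composable G \<longrightarrow> gmult G g h \<in> arrows G) \<and>
     (\<forall>g h k. (g, h) \<in> composable G \<and> (h, k) \<in> composable G \<longrightarrow>
        (gmult G g h, k) \<in> composable G \<and> (g, gmult G h k) \<in> composable G \<and>
        gmult G (gmult G g h) k = gmult G g (gmult G h k)) \<and>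
     (\<forall>g \<in> arrows G. ginv G g \<in> arrows G \<and> ginv G (ginv G g) = g \<and>
        (g, ginv G g) \<in> composable G \<and> (ginv G g, g) \<in> composable G) \<and>
     (\<forall>g h. (g, h) \<in> composable G \<longrightarrow>
        gmult G (ginv G g) (gmult G g h) = h \<and> gmult G (gmult G g h) (ginv G h) = g)"

lemma groupoid_unit_laws:
  assumes "groupoid G" "g \<in> arrows G"
  shows "(grange G g, g) \<in> composable G" "gmult G (grange G g) g = g"
    and "(g, gsource G g) \<in> composable G" "gmult G g (gsource G g) = g"
  using assms unfolding groupoid_def grange_def gsource_def by metis+

lemma groupoid_composable_iff:
  assumes "groupoid G" "g \<in> arrows G" "h \<in> arrows G"
  shows "(g, h) \<in> composable G \<longleftrightarrow> gsource G g = grange G h"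
proof
  assume "(g, h) \<in> composable G"
  with assms show "gsource G g = grange G h"
    unfolding groupoid_def grange_def gsource_def by metis
next
  assume eq: "gsource G g = grange G h"
  have "(gmult G g (gsource G g), h) \<in> composable G"
    using assms groupoid_unit_laws(3)[OF assms(1,2)] groupoid_unit_laws(1)[OF assms(1,3)] eq
    unfolding groupoid_def by metis
  then show "(g, h) \<in> composable G"
    by (simp add: groupoid_unit_laws(4)[OF assms(1,2)])
qed

definition topological_groupoid :: "('g, 'z) top_groupoid_scheme \<Rightarrow> bool" where
  "topological_groupoid G \<longleftrightarrow>
     groupoid G \<and> topspace (gtop G) = arrows G \<and>
     continuous_map (gtop G) (gtop G) (ginv G) \<and>
     continuous_map (subtopology (prod_topology (gtop G) (gtop G)) (composable G)) (gtop G)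
       (\<lambda>(g, h). gmult G g h)"

definition etale_groupoid :: "('g, 'z) top_groupoid_scheme \<Rightarrow> bool" where
  "etale_groupoid G \<longleftrightarrow>
     topological_groupoid G \<and> open_map (gtop G) (gtop G) (gsource G)"

definition groupoid_functor ::
    "('f, 'y) top_groupoid_scheme \<Rightarrow> ('g, 'z) top_groupoid_scheme \<Rightarrow> ('f \<Rightarrow> 'g) \<Rightarrow> bool" where
  "groupoid_functor F G \<pi> \<longleftrightarrow>
     \<pi> ` arrows F \<subseteq> arrows G \<and>
     (\<forall>f h. (f, h) \<in> composable F \<longrightarrow>
        (\<pi> f, \<pi> h) \<in> composable G \<and> \<pi> (gmult F f h) = gmult G (\<pi> f) (\<pi> h))"

definition isocofibration ::
    "('f, 'y) top_groupoid_scheme \<Rightarrow> ('g, 'z) top_groupoid_scheme \<Rightarrow> ('f \<Rightarrow> 'g) \<Rightarrow> bool" where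
  "isocofibration F G \<pi> \<longleftrightarrow> groupoid_functor F G \<pi> \<and> inj_on \<pi> (gunits F)"

definition groupoid_bundle ::
    "('f, 'y) top_groupoid_scheme \<Rightarrow> ('g, 'z) top_groupoid_scheme \<Rightarrow> ('f \<Rightarrow> 'g) \<Rightarrow> bool" where
  "groupoid_bundle F G \<pi> \<longleftrightarrow>
     topological_groupoid F \<and> etale_groupoid G \<and> isocofibration F G \<pi> \<and>
     continuous_map (gtop F) (gtop G) \<pi> \<and> open_map (gtop F) (gtop G) \<pi>"

definition etale_bundle ::
    "('f, 'y) top_groupoid_scheme \<Rightarrow> ('g, 'z) top_groupoid_scheme \<Rightarrow> ('f \<Rightarrow> 'g) \<Rightarrow> bool" where
  "etale_bundle F G \<pi> \<longleftrightarrow>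
     groupoid_bundle F G \<pi> \<and>
     (\<forall>f \<in> arrows F. \<exists>U. openin (gtop F) U \<and> f \<in> U \<and> inj_on \<pi> U)"


section \<open>Structured semigroups\<close>

text \<open>
  The semigroup \<open>S\<close> is the whole type \<open>'a\<close>.  Subsemigroups may be empty.
\<close>

definition subsemigroup :: "'a::semigroup_mult set \<Rightarrow> bool" where
  "subsemigroup T \<longleftrightarrow> (\<forall>x\<in>T. \<forall>y\<in>T. x * y \<in> T)"

definition center_of :: "'a::semigroup_mult set \<Rightarrow> 'a set" where
  "center_of N = {z \<in> N. \<forall>n\<in>N. n * z = z * n}"

definition structured_semigroup :: "'a::semigroup_mult set \<Rightarrow> 'a set \<Rightarrow> bool" where
  "structured_semigroup N Z \<longleftrightarrow>
     subsemigroup N \<and> subsemigroup Z \<and> Z \<subseteq> center_of N \<and>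
     (\<forall>a b. a * b \<in> Z \<and> b * a \<in> Z \<longrightarrow>
        {a * z * b | z. z \<in> Z} \<union> {b * z * a | z. z \<in> Z} \<subseteq> Z) \<and>
     (\<forall>a b. \<forall>n\<in>N. a * b * n = n \<and> n = n * a * b \<and> a * b \<in> Z \<and> b * a \<in> Z \<longrightarrow>
        b * n * a \<in> N)"

text \<open>\<open>dominated_via N Z a s b\<close> is the relation \<open>a <\<^sub>s b\<close>.\<close>

definition dominated_via :: "'a::semigroup_mult set \<Rightarrow> 'a set \<Rightarrow> 'a \<Rightarrow> 'a \<Rightarrow> 'a \<Rightarrow> bool" where
  "dominated_via N Z a s b \<longleftrightarrow>
     a * s * b = a \<and> a = b * s * a \<and> a * s \<in> N \<and> s * a \<in> N \<and> b * s \<in> Z \<and> s * b \<in> Z"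

definition dominated :: "'a::semigroup_mult set \<Rightarrow> 'a set \<Rightarrow> 'a \<Rightarrow> 'a \<Rightarrow> bool" where
  "dominated N Z a b \<longleftrightarrow> (\<exists>s. dominated_via N Z a s b)"

text \<open>\<open>up N Z A\<close> is \<open>A\<^sup><\<close> and \<open>star N Z A\<close> is \<open>A\<^sup>*\<close>.\<close>

definition up :: "'a::semigroup_mult set \<Rightarrow> 'a set \<Rightarrow> 'a set \<Rightarrow> 'a set" where
  "up N Z A = {b. \<exists>a\<in>A. dominated N Z a b}"

definition star :: "'a::semigroup_mult set \<Rightarrow> 'a set \<Rightarrow> 'a set \<Rightarrow> 'a set" where
  "star N Z A = {s. \<exists>a\<in>A. \<exists>b. dominated_via N Z a s b}"

text \<open>Products of subsets are the elementwise ones of \<^theory>\<open>HOL-Library.Set_Algebras\<close>.\<close>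

definition atlas :: "'a::semigroup_mult set \<Rightarrow> 'a set \<Rightarrow> 'a set \<Rightarrow> bool" where
  "atlas N Z A \<longleftrightarrow> A * star N Z A * A \<subseteq> A \<and> A \<subseteq> up N Z A"

definition coset :: "'a::semigroup_mult set \<Rightarrow> 'a set \<Rightarrow> 'a set \<Rightarrow> bool" where
  "coset N Z C \<longleftrightarrow> C * star N Z C * C \<subseteq> C \<and> C = up N Z C"

definition atlas_source :: "'a::semigroup_mult set \<Rightarrow> 'a set \<Rightarrow> 'a set \<Rightarrow> 'a set" where
  "atlas_source N Z A = up N Z (star N Z A * A)"

definition atlas_range :: "'a::semigroup_mult set \<Rightarrow> 'a set \<Rightarrow> 'a set \<Rightarrow> 'a set" where
  "atlas_range N Z A = up N Z (A * star N Z A)"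


section \<open>The coset groupoid\<close>

definition cosets :: "'a::semigroup_mult set \<Rightarrow> 'a set \<Rightarrow> 'a set set" where
  "cosets N Z = {C. coset N Z C \<and> C \<noteq> {}}"

definition coset_groupoid :: "'a::semigroup_mult set \<Rightarrow> 'a set \<Rightarrow> 'a set top_groupoid" where
  "coset_groupoid N Z =
     \<lparr> arrows = cosets N Z,
       composable = {(B, C). B \<in> cosets N Z \<and> C \<in> cosets N Z \<and>
                             atlas_source N Z B = atlas_range N Z C},
       gmult = (\<lambda>B C. up N Z (B * C)),
       ginv = star N Z,
       gtop = topology_generated_by {{C \<in> cosets N Z. a \<in> C} | a. True} \<rparr>"


section \<open>The groupoid of coset germs\<close>

definition germ_rel :: "'a::semigroup_mult set \<Rightarrow> 'a set \<Rightarrow> 'a set \<Rightarrow> 'a rel" where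
  "germ_rel N Z A = {(a, b). a \<in> up N Z A \<and> b \<in> up N Z A \<and>
     (\<exists>s\<in>star N Z A. \<exists>t\<in>star N Z A. s * a * t = s * b * t)}"

text \<open>\<open>germ N Z a A\<close> is \<open>[a, A]\<close>.\<close>

definition germ :: "'a::semigroup_mult set \<Rightarrow> 'a set \<Rightarrow> 'a \<Rightarrow> 'a set \<Rightarrow> 'a set \<times> 'a set" where
  "germ N Z a A = (germ_rel N Z A `` {a}, up N Z A)"

definition germs :: "'a::semigroup_mult set \<Rightarrow> 'a set \<Rightarrow> ('a set \<times> 'a set) set" where
  "germs N Z = {germ N Z c C | c C. C \<in> cosets N Z \<and> c \<in> C}"

definition germ_composable ::
    "'a::semigroup_mult set \<Rightarrow> 'a set \<Rightarrow> (('a set \<times> 'a set) \<times> ('a set \<times> 'a set)) set" where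
  "germ_composable N Z = {(germ N Z a A, germ N Z b B) | a A b B.
     atlas N Z A \<and> a \<in> up N Z A \<and> atlas N Z B \<and> b \<in> up N Z B \<and>
     atlas_source N Z A = atlas_range N Z B}"

text \<open>
  Product and inverse are defined on representatives; the use of a definite description makes
  independence of the representatives part of the claim that one obtains a groupoid.
\<close>

definition germ_mult ::
    "'a::semigroup_mult set \<Rightarrow> 'a set \<Rightarrow> 'a set \<times> 'a set \<Rightarrow> 'a set \<times> 'a set \<Rightarrow> 'a set \<times> 'a set" where
  "germ_mult N Z x y = (THE z. \<exists>a A b B.
     atlas N Z A \<and> a \<in> up N Z A \<and> atlas N Z B \<and> b \<in> up N Z B \<and>
     atlas_source N Z A = atlas_range N Z B \<and>
     x = germ N Z a A \<and> y = germ N Z b B \<and> z = germ N Z (a * b) (A * B))"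

definition germ_inv ::
    "'a::semigroup_mult set \<Rightarrow> 'a set \<Rightarrow> 'a set \<times> 'a set \<Rightarrow> 'a set \<times> 'a set" where
  "germ_inv N Z x = (THE y. \<exists>c C d c'.
     C \<in> cosets N Z \<and> c \<in> C \<and> d \<in> C \<and> dominated_via N Z d c' c \<and>
     x = germ N Z c C \<and> y = germ N Z c' (star N Z C))"

definition germ_groupoid ::
    "'a::semigroup_mult set \<Rightarrow> 'a set \<Rightarrow> ('a set \<times> 'a set) top_groupoid" where
  "germ_groupoid N Z =
     \<lparr> arrows = germs N Z,
       composable = germ_composable N Z,
       gmult = germ_mult N Z,
       ginv = germ_inv N Z,
       gtop = topology_generated_by
         ({{germ N Z s C | C. C \<in> cosets N Z \<and> s \<in> C} | s. True} \<union>
          {{germ N Z c C | c C. C \<in> cosets N Z \<and> c \<in> C \<and> s \<in> C} | s. True}) \<rparr>"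

text \<open>The projection \<open>[a, A] \<mapsto> A\<^sup><\<close>.\<close>

definition germ_proj :: "'a set \<times> 'a set \<Rightarrow> 'a set" where
  "germ_proj = snd"

end

theory Submission
  imports Defs
begin

text \<open>
  Write \<open>a \<prec>[s] b\<close> for \<open>a <\<^sub>s b\<close>: the element \<open>s\<close> inverts \<open>b\<close> where \<open>a\<close> lives, because the
  elements \<open>b s\<close> and \<open>s b\<close> of \<open>Z\<close> act on \<open>a\<close> as units.  All algebra rests on a small calculus
  for this relation.  It is transitive and multiplicative (\<open>via_trans\<close>, \<open>via_mult\<close>), it survives
  multiplying the smaller element by \<open>N\<close> (\<open>via_N_left\<close>, \<open>via_N_right\<close>), it is turned into domination
  between the inverses (\<open>via_swap\<close>, \<open>via_flip\<close>), and it can be divided by a factor of the smaller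
  element (\<open>via_quot_right\<close>, \<open>via_quot_left\<close>).

  The coset groupoid.  For sets that lie in their own up-closure, up-closure absorbs the up-closures
  of factors (\<open>up_times_up\<close>), so identities between cosets may be checked on
  generating sets.  For an atlas \<open>A\<close> the set \<open>A\<^sup>*\<close> is a coset with \<open>A\<^sup>*\<^sup>* = A\<^sup><\<close>, and \<open>A A\<^sup>* A\<close> generates
  the same coset as \<open>A\<close>.  If \<open>\<^bold>s(A) = \<^bold>r(B)\<close>, dividing by \<open>b\<close> shows that each \<open>s \<in> (AB)\<^sup>*\<close>
  satisfies \<open>B s \<subseteq> A\<^sup>*\<close>; hence \<open>AB\<close> is an atlas and \<open>(AB)\<^sup>* = (B\<^sup>* A\<^sup>*)\<^sup><\<close>.  The groupoid laws follow.
  Membership in \<open>C\<^sup>*\<close> and in \<open>(BC)\<^sup><\<close> is witnessed by single elements of the factors,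
  which gives continuity.  The source map is open because \<open>C\<close> can be translated: a coset \<open>D\<close> near
  \<open>\<^bold>s(C)\<close> is again a unit, and for a suitable \<open>a \<in> C\<close> the up-closure of \<open>a D\<close> is a coset near \<open>C\<close>
  with source \<open>D\<close> (\<open>translate_unit\<close>).

  The germs.  Two elements of \<open>C\<close> have the same germ iff \<open>z a w = z b w\<close> for some
  \<open>z \<in> Z \<inter> \<^bold>r(C)\<close> and \<open>w \<in> Z \<inter> \<^bold>s(C)\<close> (\<open>germ_relI\<close>, \<open>germ_relE\<close>).  As \<open>Z\<close> is commutative, this is
  an equivalence.  It is compatible with products because a central multiplier between two factors
  can be moved to the outside: \<open>w b (u b) = b (u w b)\<close> for \<open>b u, w \<in> Z\<close>.  If \<open>d \<prec>[c'] c\<close>,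
  then \<open>c' c\<close> and \<open>c c'\<close> represent units, so the germ of \<open>c'\<close> is well defined by
  uniqueness of inverses in a groupoid (\<open>germ_rel_inverse\<close>).

  The topology.  Equality of the germs of \<open>a\<close> and \<open>b\<close> at \<open>C\<close> is witnessed by two elements of \<open>C\<close>,
  so it persists on all cosets containing them.  Therefore the germs of one fixed \<open>c\<close> at all
  cosets containing \<open>c\<close> and a given finite set \<open>F \<subseteq> C\<close> form a neighbourhood base at \<open>[c, C]\<close>
  (\<open>openin_GG_D\<close>).  The projection maps such a neighbourhood bijectively onto the set of
  cosets containing \<open>F\<close> and \<open>c\<close>, so it is continuous, open and locally injective.
  It is injective on units because all unit germs \<open>[c' c, \<^bold>s(C)]\<close> over the same unit coset coincide.
\<close>


section \<open>Continuity and bases\<close>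

lemma openin_generated_iff:
  "openin (topology_generated_by S) U \<longleftrightarrow>
     (\<forall>x\<in>U. \<exists>F. finite F \<and> F \<noteq> {} \<and> F \<subseteq> S \<and> x \<in> \<Inter>F \<and> \<Inter>F \<subseteq> U)"
proof
  assume "openin (topology_generated_by S) U"
  then have "generate_topology_on S U"
    by (simp add: openin_topology_generated_by_iff)
  then show "\<forall>x\<in>U. \<exists>F. finite F \<and> F \<noteq> {} \<and> F \<subseteq> S \<and> x \<in> \<Inter>F \<and> \<Inter>F \<subseteq> U"
  proof induction
    case (Int a b)
    show ?case
    proof
      fix x assume "x \<in> a \<inter> b"
      then have x: "x \<in> a" "x \<in> b" by auto
      obtain F where "finite F" "F \<noteq> {}" "F \<subseteq> S" "x \<in> \<Inter>F" "\<Inter>F \<subseteq> a"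
        using bspec[OF Int.IH(1) x(1)] by (elim exE conjE)
      moreover obtain G where "finite G" "G \<noteq> {}" "G \<subseteq> S" "x \<in> \<Inter>G" "\<Inter>G \<subseteq> b"
        using bspec[OF Int.IH(2) x(2)] by (elim exE conjE)
      ultimately show "\<exists>F. finite F \<and> F \<noteq> {} \<and> F \<subseteq> S \<and> x \<in> \<Inter>F \<and> \<Inter>F \<subseteq> a \<inter> b"
        by (intro exI[of _ "F \<union> G"]) auto
    qed
  next
    case (UN K)
    show ?case
    proof
      fix x assume "x \<in> \<Union>K"
      then obtain k where k: "k \<in> K" "x \<in> k" by blast
      obtain F where "finite F" "F \<noteq> {}" "F \<subseteq> S" "x \<in> \<Inter>F" "\<Inter>F \<subseteq> k"
        using bspec[OF UN.IH[OF k(1)] k(2)] by (elim exE conjE)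
      with k(1) show "\<exists>F. finite F \<and> F \<noteq> {} \<and> F \<subseteq> S \<and> x \<in> \<Inter>F \<and> \<Inter>F \<subseteq> \<Union>K"
        by (intro exI[of _ F] conjI) auto
    qed
  next
    case (Basis s)
    then show ?case
      by (intro ballI exI[of _ "{s}"]) auto
  qed simp
next
  assume R: "\<forall>x\<in>U. \<exists>F. finite F \<and> F \<noteq> {} \<and> F \<subseteq> S \<and> x \<in> \<Inter>F \<and> \<Inter>F \<subseteq> U"
  show "openin (topology_generated_by S) U"
  proof (subst openin_subopen, rule ballI)
    fix x assume "x \<in> U"
    obtain F where F: "finite F" "F \<noteq> {}" "F \<subseteq> S" "x \<in> \<Inter>F" "\<Inter>F \<subseteq> U"
      using bspec[OF R \<open>x \<in> U\<close>] by (elim exE conjE)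
    have "openin (topology_generated_by S) (\<Inter>F)"
      using F(1-3) by (intro openin_Inter) (auto intro: topology_generated_by_Basis)
    with F show "\<exists>T. openin (topology_generated_by S) T \<and> x \<in> T \<and> T \<subseteq> U"
      by (intro exI[of _ "\<Inter>F"] conjI)
  qed
qed

lemma continuous_map_prod_subI:
  assumes R: "R \<subseteq> topspace X \<times> topspace Y"
    and f: "\<And>x y. (x, y) \<in> R \<Longrightarrow> f x y \<in> topspace T"
    and nbhd: "\<And>x y U. (x, y) \<in> R \<Longrightarrow> openin T U \<Longrightarrow> f x y \<in> U \<Longrightarrow>
      \<exists>V W. openin X V \<and> openin Y W \<and> x \<in> V \<and> y \<in> W \<and>
        (\<forall>x' y'. (x', y') \<in> R \<longrightarrow> x' \<in> V \<longrightarrow> y' \<in> W \<longrightarrow> f x' y' \<in> U)"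
  shows "continuous_map (subtopology (prod_topology X Y) R) T (\<lambda>(x, y). f x y)"
proof -
  let ?P = "subtopology (prod_topology X Y) R"
  have top: "topspace ?P = R"
    using R by auto
  show ?thesis
    unfolding continuous_map_def top
  proof (intro conjI allI impI)
    show "(\<lambda>(x, y). f x y) \<in> R \<rightarrow> topspace T"
      using f by auto
    fix U assume U: "openin T U"
    show "openin ?P {p \<in> R. (case p of (x, y) \<Rightarrow> f x y) \<in> U}"
    proof (subst openin_subopen, rule ballI)
      fix p assume "p \<in> {p \<in> R. (case p of (x, y) \<Rightarrow> f x y) \<in> U}"
      then obtain x y where p: "p = (x, y)" "(x, y) \<in> R" "f x y \<in> U"
        by (cases p) auto
      obtain V W where "openin X V" "openin Y W" "x \<in> V" "y \<in> W"
        and VW: "\<forall>x' y'. (x', y') \<in> R \<longrightarrow> x' \<in> V \<longrightarrow> y' \<in> W \<longrightarrow> f x' y' \<in> U"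
        using nbhd[OF p(2) U p(3)] by blast
      moreover have "openin ?P (V \<times> W \<inter> R)"
        using calculation(1,2) by (intro openin_subtopology_Int) (simp add: openin_prod_Times_iff)
      ultimately show "\<exists>T. openin ?P T \<and> p \<in> T \<and> T \<subseteq> {p \<in> R. (case p of (x, y) \<Rightarrow> f x y) \<in> U}"
        using p by (intro exI[of _ "V \<times> W \<inter> R"]) auto
    qed
  qed
qed


section \<open>The calculus of the domination relation\<close>

locale structured =
  fixes N Z :: "'a::semigroup_mult set"
  assumes structured: "structured_semigroup N Z"
begin

abbreviation via :: "'a \<Rightarrow> 'a \<Rightarrow> 'a \<Rightarrow> bool" ("_ \<prec>[_] _" [51, 0, 51] 50)
  where "a \<prec>[s] b \<equiv> dominated_via N Z a s b"

abbreviation upset :: "'a set \<Rightarrow> 'a set" ("_\<^sup>\<up>" [1000] 1000)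
  where "A\<^sup>\<up> \<equiv> up N Z A"

abbreviation starset :: "'a set \<Rightarrow> 'a set" ("_\<^sup>\<star>" [1000] 1000)
  where "A\<^sup>\<star> \<equiv> star N Z A"

abbreviation src :: "'a set \<Rightarrow> 'a set" where "src \<equiv> atlas_source N Z"
abbreviation rng :: "'a set \<Rightarrow> 'a set" where "rng \<equiv> atlas_range N Z"

lemma N_mult: "m \<in> N \<Longrightarrow> n \<in> N \<Longrightarrow> m * n \<in> N"
  using structured by (simp add: structured_semigroup_def subsemigroup_def)

lemma Z_mult: "y \<in> Z \<Longrightarrow> z \<in> Z \<Longrightarrow> y * z \<in> Z"
  using structured by (simp add: structured_semigroup_def subsemigroup_def)

lemma Z_N: "z \<in> Z \<Longrightarrow> z \<in> N"
  using structured by (auto simp: structured_semigroup_def center_of_def)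

lemma Z_comm: "z \<in> Z \<Longrightarrow> n \<in> N \<Longrightarrow> n * z = z * n"
  using structured by (auto simp: structured_semigroup_def center_of_def)

lemma Z_conj: "a * b \<in> Z \<Longrightarrow> b * a \<in> Z \<Longrightarrow> z \<in> Z \<Longrightarrow> a * (z * b) \<in> Z"
  using structured unfolding structured_semigroup_def mult.assoc by blast

text \<open>The two-sided unit condition of axiom (ii) follows from the one-sided one, as \<open>a b\<close> is central in
  \<open>N\<close>.\<close>

lemma N_conj:
  assumes "a * b \<in> Z" "b * a \<in> Z" "n \<in> N" "a * (b * n) = n"
  shows "b * (n * a) \<in> N"
proof -
  have "n * (a * b) = n"
    using Z_comm[OF assms(1,3)] assms(4) by (simp add: mult.assoc)
  then show ?thesis
    using structured assms unfolding structured_semigroup_def mult.assoc by metis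
qed

text \<open>The equations are stated with products nested to the right, the normal form that \<open>mult.assoc\<close>
  produces; this makes the facts of \<open>viaD\<close> usable as rewrite rules inside longer products.\<close>

lemma viaI:
  assumes "a * (s * b) = a" "b * (s * a) = a" "a * s \<in> N" "s * a \<in> N" "b * s \<in> Z" "s * b \<in> Z"
  shows "a \<prec>[s] b"
  using assms by (simp add: dominated_via_def mult.assoc)

lemma viaD:
  assumes "a \<prec>[s] b"
  shows "a * (s * b) = a" "b * (s * a) = a" "a * s \<in> N" "s * a \<in> N" "b * s \<in> Z" "s * b \<in> Z"
    and "a * (s * (b * x)) = a * x" "b * (s * (a * x)) = a * x"
  using assms by (auto simp: dominated_via_def mult.assoc) (metis mult.assoc)+

lemma N_mult_assoc: "a * s \<in> N \<Longrightarrow> b * t \<in> N \<Longrightarrow> a * (s * (b * t)) \<in> N"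
  using N_mult[of "a * s" "b * t"] by (simp add: mult.assoc)

lemma Z_comm_assoc: "z * y \<in> Z \<Longrightarrow> n * m \<in> N \<Longrightarrow> n * (m * (z * y)) = z * (y * (n * m))"
  using Z_comm[of "z * y" "n * m"] by (simp add: mult.assoc)

lemma Z_comm_assoc_mult: "z * y \<in> Z \<Longrightarrow> n * m \<in> N \<Longrightarrow> n * (m * (z * (y * x))) = z * (y * (n * (m * x)))"
  using Z_comm[of "z * y" "n * m"] by (metis mult.assoc)

lemma via_trans:
  assumes ab: "a \<prec>[s] b" and bc: "b \<prec>[t] c"
  shows "a \<prec>[t] c"
proof (rule viaI)
  show "a * (t * c) = a"
    by (metis viaD(1)[OF ab] viaD(1)[OF bc] mult.assoc)
  show "c * (t * a) = a"
    by (metis viaD(2)[OF ab] viaD(2)[OF bc] mult.assoc)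
  show "a * t \<in> N"
    using N_mult_assoc[OF viaD(3)[OF ab] viaD(3)[OF bc]]
    by (simp add: viaD(7)[OF ab])
  show "t * a \<in> N"
    using N_mult_assoc[OF viaD(4)[OF bc] viaD(4)[OF ab]] by (simp add: viaD[OF ab])
qed (use viaD[OF bc] in auto)

text \<open>The outer conditions come from axiom (i).  For the memberships in \<open>N\<close>, conjugate
  \<open>(s a)(c t) \<in> N\<close> by \<open>b\<close>, \<open>s\<close> and by \<open>d\<close>, \<open>t\<close>: on this element both \<open>s b\<close> and \<open>d t\<close> act as units,
  so axiom (ii) applies.\<close>

lemma via_mult:
  assumes ab: "a \<prec>[s] b" and cd: "c \<prec>[t] d"
  shows "a * c \<prec>[t * s] b * d"
proof (rule viaI; (unfold mult.assoc)?)
  note A = viaD[OF ab] and C = viaD[OF cd]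
  show "a * (c * (t * (s * (b * d)))) = a * c"
    using Z_comm_assoc_mult[OF A(6) C(3)] by (simp add: A C)
  show "b * (d * (t * (s * (a * c)))) = a * c"
    using Z_comm_assoc_mult[OF C(5) A(4), symmetric] by (simp add: A C)
  have "s * (a * (c * t)) \<in> N"
    using N_mult_assoc[OF A(4) C(3)] .
  with N_conj[OF A(6,5) this] show "a * (c * (t * s)) \<in> N"
    by (simp add: A mult.assoc)
  have "s * (a * (c * t)) \<in> N" "d * (t * (s * (a * (c * t)))) = s * (a * (c * t))"
    using N_mult_assoc[OF A(4) C(3)] Z_comm_assoc_mult[OF C(5) A(4), symmetric] by (simp_all add: C)
  from N_conj[OF C(5,6) this] show "t * (s * (a * c)) \<in> N"
    by (simp add: C mult.assoc)
  show "b * (d * (t * s)) \<in> Z"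
    using Z_conj[OF A(5,6) C(5)] by (simp add: mult.assoc)
  show "t * (s * (b * d)) \<in> Z"
    using Z_conj[OF C(6,5) A(6)] by (simp add: mult.assoc)
qed

lemma via_N_left:
  assumes n: "n \<in> N" and cd: "c \<prec>[t] d"
  shows "n * c \<prec>[t] d"
proof (rule viaI; (unfold mult.assoc)?)
  note C = viaD[OF cd]
  show "n * (c * (t * d)) = n * c"
    by (simp add: C)
  have comm: "d * (t * (n * x)) = n * (d * (t * x))" for x
    using Z_comm[OF C(5) n] by (metis mult.assoc)
  show "d * (t * (n * c)) = n * c"
    by (simp add: comm C)
  show m: "n * (c * t) \<in> N"
    using N_mult[OF n C(3)] .
  show "t * (n * c) \<in> N"
    using N_conj[OF C(5,6) m] by (simp add: comm C mult.assoc)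
qed (use viaD[OF cd] in auto)

lemma via_N_right:
  assumes n: "n \<in> N" and cd: "c \<prec>[t] d"
  shows "c * n \<prec>[t] d"
proof (rule viaI; (unfold mult.assoc)?)
  note C = viaD[OF cd]
  have comm: "n * (t * d) = t * (d * n)"
    using Z_comm[OF C(6) n] by (metis mult.assoc)
  show "c * (n * (t * d)) = c * n"
    by (simp add: comm C)
  show "d * (t * (c * n)) = c * n"
    by (simp add: C)
  show m: "t * (c * n) \<in> N"
    using N_mult[OF C(4) n] by (simp add: mult.assoc)
  show "c * (n * t) \<in> N"
    using N_conj[OF C(6,5) m] by (simp add: C mult.assoc)
qed (use viaD[OF cd] in auto)

text \<open>Together with \<open>via_swap\<close>: the inverse \<open>s\<close> of \<open>a\<close> can be cut down to \<open>u a s\<close>, which still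
  serves as an inverse for the smaller \<open>a'\<close> and is itself dominated by \<open>s\<close>.  This is the reason that
  \<open>A\<^sup>\<star>\<close> lies in its own up-closure.\<close>

lemma via_restrict:
  assumes "a' \<prec>[u] a" "a \<prec>[s] b"
  shows "a' \<prec>[u * (a * s)] b"
proof (rule viaI; (unfold mult.assoc)?)
  note A' = viaD[OF assms(1)] and A = viaD[OF assms(2)] and T = viaD[OF via_trans[OF assms]]
  show "a' * (u * (a * (s * b))) = a'"
    by (simp add: A A')
  show "b * (u * (a * (s * a'))) = a'"
    using Z_comm_assoc[OF A'(6) T(4), symmetric] by (simp add: T A')
  show "a' * (u * (a * s)) \<in> N"
    by (simp add: A' T)
  show "u * (a * (s * a')) \<in> N"
    using N_mult_assoc[OF Z_N[OF A'(6)] T(4)] .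
  show "b * (u * (a * s)) \<in> Z"
    using Z_conj[OF A(5,6) A'(6)] by (simp add: mult.assoc)
  show "u * (a * (s * b)) \<in> Z"
    by (simp add: A A')
qed

lemma via_swap:
  assumes "a' \<prec>[u] a" "a \<prec>[s] b"
  shows "u * (a * s) \<prec>[b] s"
proof (rule viaI; (unfold mult.assoc)?)
  note A' = viaD[OF assms(1)] and A = viaD[OF assms(2)]
  show "u * (a * (s * (b * s))) = u * (a * s)"
    by (simp add: A)
  show "s * (b * (u * (a * s))) = u * (a * s)"
    using Z_comm_assoc_mult[OF A'(6) Z_N[OF A(6)]] by (simp add: A)
  show "u * (a * (s * b)) \<in> N"
    by (simp add: A Z_N[OF A'(6)])
  show "b * (u * (a * s)) \<in> N"
    using Z_conj[OF A(5,6) A'(6)] by (simp add: mult.assoc Z_N)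
qed (use viaD[OF assms(2)] in auto)

text \<open>With \<open>via_flip\<close>, this passes from \<open>s\<close> to an element \<open>t\<close> above it.  The element \<open>a\<close> itself is too
  large to be inverted by \<open>t\<close>: one only knows \<open>v s \<in> N\<close>, which has no inverse in \<open>N\<close> in general.
  Multiplying by that element of \<open>N\<close> repairs this, and \<open>a (s v s) a\<close> is still in the atlas of \<open>a\<close>
  because \<open>s v s\<close> is in its star.\<close>

lemma via_flip_star:
  assumes "a \<prec>[s] b" "s \<prec>[v] t"
  shows "a \<prec>[s * (v * s)] b * (t * b)"
proof (rule viaI; (unfold mult.assoc)?)
  note A = viaD[OF assms(1)] and S = viaD[OF assms(2)]
  have 1: "s * (v * (s * (b * (t * x)))) = s * (b * (s * x))" for x
    using Z_comm_assoc_mult[OF A(6) S(3)] by (simp add: S)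
  have 2: "b * (t * (b * (s * (v * (s * x))))) = b * (s * (b * (s * x)))" for x
    using Z_comm_assoc_mult[OF A(5) S(4), symmetric] by (simp add: S)
  have 3: "b * (t * (b * (s * (v * s)))) = b * (s * (b * s))"
    using Z_comm_assoc[OF A(5) S(4), symmetric] by (simp add: S)
  show "a * (s * (v * (s * (b * (t * b))))) = a"
    by (simp add: 1 A)
  show "b * (t * (b * (s * (v * (s * a))))) = a"
    by (simp add: 2 A)
  show "a * (s * (v * s)) \<in> N"
    using N_mult_assoc[OF A(3) S(4)] .
  show "s * (v * (s * a)) \<in> N"
    using N_mult_assoc[OF S(3) A(4)] .
  show "b * (t * (b * (s * (v * s)))) \<in> Z"
    using Z_mult[OF A(5,5)] by (simp add: 3 mult.assoc)
  show "s * (v * (s * (b * (t * b)))) \<in> Z"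
    using Z_mult[OF A(6,6)] by (simp add: 1 mult.assoc)
qed

lemma via_flip:
  assumes "a \<prec>[s] b" "s \<prec>[v] t"
  shows "a * (s * (v * (s * a))) \<prec>[t] v"
proof (rule viaI; (unfold mult.assoc)?)
  note A = viaD[OF assms(1)] and S = viaD[OF assms(2)]
  have 1: "t * (v * (s * a)) = s * a" and 2: "s * (a * (t * v)) = s * a"
    using Z_comm_assoc[OF S(5) A(4)] by (simp_all add: S)
  have 3: "v * (t * (a * (s * x))) = a * (s * x)" for x
    using Z_comm_assoc_mult[OF S(6) A(3), symmetric] by (simp add: S)
  have 4: "v * (t * (a * s)) = a * s"
    using Z_comm_assoc[OF S(6) A(3), symmetric] by (simp add: S)
  have 5: "v * (s * (a * t)) \<in> N"
    using N_conj[OF S(5,6) A(4) 1] by (simp add: mult.assoc)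
  have 6: "t * (a * (s * v)) \<in> N"
    using N_conj[OF S(6,5) A(3) 4] by (simp add: mult.assoc)
  show "a * (s * (v * (s * (a * (t * v))))) = a * (s * (v * (s * a)))"
    by (simp add: 2)
  show "v * (t * (a * (s * (v * (s * a))))) = a * (s * (v * (s * a)))"
    by (simp add: 3)
  show "a * (s * (v * (s * (a * t)))) \<in> N"
    using N_mult[OF A(3) 5] by (simp add: mult.assoc)
  show "t * (a * (s * (v * (s * a)))) \<in> N"
    using N_mult[OF 6 A(4)] by (simp add: mult.assoc)
qed (use viaD[OF assms(2)] in auto)

text \<open>Division by a factor: if \<open>s\<close> inverts something above \<open>b c\<close>, then \<open>c s\<close> inverts
  something above a restriction of \<open>b\<close>, the restriction being multiplication by \<open>c' q\<close> in \<open>N\<close>.\<close>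

lemma via_quot_right:
  assumes "b * c \<prec>[s] d" "c' \<prec>[q] c"
  shows "b * (c' * q) \<prec>[c * s] d * q"
proof (rule viaI; (unfold mult.assoc)?)
  note B = viaD[OF assms(1), unfolded mult.assoc] and C = viaD[OF assms(2)]
  have z: "c * (s * (d * q)) \<in> Z"
    using Z_conj[OF _ _ B(6), of c q] C by (simp add: mult.assoc)
  have z': "d * (q * (c * s)) \<in> Z"
    using Z_conj[OF B(5,6) C(6)] by (simp add: mult.assoc)
  have m: "s * (b * (c * (q * c'))) \<in> N"
    using N_mult[OF B(4) C(4)] by (simp add: mult.assoc)
  have cc: "c * (q * c') = c'" "c * (q * (c' * x)) = c' * x" for x
    by (simp_all add: C)
  have bc: "b * (c * (s * (d * x))) = b * (c * x)" "d * (s * (b * (c * x))) = b * (c * x)" for x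
    using B(7,8)[of x] by simp_all
  have e: "d * (s * (b * (c' * x))) = b * (c' * x)" for x
    using bc(2)[of "q * (c' * x)"] by (simp add: cc)
  show "b * (c' * (q * (c * (s * (d * q))))) = b * (c' * q)"
    using Z_comm[OF z C(3)] by (simp add: mult.assoc bc cc)
  have "q * (c * (s * (b * (c' * q)))) = s * (b * (c' * (q * (c * q))))"
    using Z_comm[OF C(6) m] by (simp add: cc) (metis mult.assoc)
  then show "d * (q * (c * (s * (b * (c' * q))))) = b * (c' * q)"
    by (simp add: e C)
  show "b * (c' * (q * (c * s))) \<in> N"
    using N_conj[OF B(6,5) m] bc(2)[of "q * c'"] unfolding mult.assoc cc e by (simp add: C)
  show "c * (s * (b * (c' * q))) \<in> N"
    using N_conj[OF C(6,5) m] Z_comm[OF C(6) m] by (simp add: cc C mult.assoc)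
  show "d * (q * (c * s)) \<in> Z" by (fact z')
  show "c * (s * (d * q)) \<in> Z" by (fact z)
qed

lemma via_quot_left:
  assumes "b * c \<prec>[s] d" "b' \<prec>[p] b"
  shows "p * (b' * c) \<prec>[s * b] p * d"
proof (rule viaI; (unfold mult.assoc)?)
  note B = viaD[OF assms(1), unfolded mult.assoc] and C = viaD[OF assms(2)]
  have z: "p * (d * (s * b)) \<in> Z"
    using Z_conj[OF _ _ B(5), of p b] C by (simp add: mult.assoc)
  have z': "s * (b * (p * d)) \<in> Z"
    using Z_conj[OF B(6,5) C(5)] by (simp add: mult.assoc)
  have m: "b' * (c * s) \<in> N"
    using N_mult[OF C(3) B(3)] by (simp add: mult.assoc C)
  have bc: "b' * (c * (s * d)) = b' * c"
    using arg_cong[OF B(1), of "\<lambda>x. b' * (p * x)"] by (simp add: C)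
  have bc': "b' * (c * (s * (d * x))) = b' * (c * x)" for x
    using bc by (metis mult.assoc)
  have dsb: "d * (s * (b' * c)) = b' * c"
  proof -
    have "d * s * (b' * p) = b' * p * (d * s)"
      using Z_comm[OF B(5) C(3)] by simp
    then have "d * (s * (b' * (p * (b * c)))) = b' * (p * (d * (s * (b * c))))"
      by (metis mult.assoc)
    then show ?thesis by (simp add: C B)
  qed
  show "p * (b' * (c * (s * (b * (p * d))))) = p * (b' * c)"
  proof -
    have "b' * (c * s) * (b * p) = b * p * (b' * (c * s))"
      using Z_comm[OF C(5) m] .
    then have "b' * (c * (s * (b * (p * d)))) = b * (p * (b' * (c * (s * d))))"
      by (metis mult.assoc)
    then show ?thesis by (simp add: bc C)
  qed
  show "p * (d * (s * (b * (p * (b' * c))))) = p * (b' * c)"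
    by (simp add: C dsb)
  show "p * (b' * (c * (s * b))) \<in> N"
    using N_conj[OF C(5,6) m] by (simp add: C mult.assoc)
  show "s * (b * (p * (b' * c))) \<in> N"
    using N_conj[OF B(5,6) m] dsb bc Z_comm[OF B(5) m] by (simp add: C mult.assoc bc')
  show "p * (d * (s * b)) \<in> Z" by (fact z)
  show "s * (b * (p * d)) \<in> Z" by (fact z')
qed


section \<open>Atlases and cosets\<close>

lemma up_iff: "b \<in> X\<^sup>\<up> \<longleftrightarrow> (\<exists>a\<in>X. \<exists>s. a \<prec>[s] b)"
  by (simp add: up_def dominated_def)

lemma in_upI: "a \<in> X \<Longrightarrow> a \<prec>[s] b \<Longrightarrow> b \<in> X\<^sup>\<up>"
  by (auto simp: up_iff)

lemma star_iff: "s \<in> X\<^sup>\<star> \<longleftrightarrow> (\<exists>a\<in>X. \<exists>b. a \<prec>[s] b)"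
  by (simp add: star_def)

abbreviation dense :: "'a set \<Rightarrow> bool" where "dense X \<equiv> X \<subseteq> X\<^sup>\<up>"

lemma up_mono: "X \<subseteq> Y \<Longrightarrow> X\<^sup>\<up> \<subseteq> Y\<^sup>\<up>"
  unfolding up_iff subset_iff by blast

lemma up_up: "X\<^sup>\<up>\<^sup>\<up> \<subseteq> X\<^sup>\<up>"
  unfolding subset_iff up_iff Bex_def using via_trans by blast

lemma up_idem: "dense X \<Longrightarrow> X\<^sup>\<up>\<^sup>\<up> = X\<^sup>\<up>"
  using up_up up_mono by blast

lemma dense_up: "dense X \<Longrightarrow> dense (X\<^sup>\<up>)"
  by (simp add: up_idem)

lemma up_subsetI: "X \<subseteq> Y\<^sup>\<up> \<Longrightarrow> X\<^sup>\<up> \<subseteq> Y\<^sup>\<up>"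
  using up_up up_mono by blast

lemma up_times: "X\<^sup>\<up> * Y\<^sup>\<up> \<subseteq> (X * Y)\<^sup>\<up>"
proof
  fix x assume "x \<in> X\<^sup>\<up> * Y\<^sup>\<up>"
  then obtain b d a c s t where "x = b * d" "a \<in> X" "a \<prec>[s] b" "c \<in> Y" "c \<prec>[t] d"
    by (auto simp: up_iff elim!: set_times_elim)
  then show "x \<in> (X * Y)\<^sup>\<up>"
    using in_upI[OF set_times_intro via_mult] by simp
qed

lemma dense_times: "dense X \<Longrightarrow> dense Y \<Longrightarrow> dense (X * Y)"
  using up_times set_times_mono2 by (meson order_trans)

text \<open>The rule that allows all computations with cosets to be done on generating sets.\<close>

lemma up_times_up: "dense X \<Longrightarrow> dense Y \<Longrightarrow> (X\<^sup>\<up> * Y\<^sup>\<up>)\<^sup>\<up> = (X * Y)\<^sup>\<up>"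
  by (intro antisym up_subsetI up_times up_mono set_times_mono2)

lemma up_times_cong:
  assumes "dense X" "dense X'" "X\<^sup>\<up> = X'\<^sup>\<up>" "dense Y" "dense Y'" "Y\<^sup>\<up> = Y'\<^sup>\<up>"
  shows "(X * Y)\<^sup>\<up> = (X' * Y')\<^sup>\<up>"
  using assms up_times_up by metis

lemma star_up: "dense X \<Longrightarrow> (X\<^sup>\<up>)\<^sup>\<star> = X\<^sup>\<star>"
  unfolding set_eq_iff star_iff using via_trans by (metis up_iff subset_iff)

lemma in_starI: "a \<in> X \<Longrightarrow> a \<prec>[s] b \<Longrightarrow> s \<in> X\<^sup>\<star>"
  by (auto simp: star_iff)

text \<open>The element \<open>s'\<close> is the restriction of \<open>s\<close> from \<open>via_swap\<close>.\<close>

lemma star_below: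
  assumes "dense X" "a \<in> X" "a \<prec>[s] b"
  obtains s' where "s' \<in> X\<^sup>\<star>" "s' \<prec>[b] s"
proof -
  from assms obtain a' u where "a' \<in> X" "a' \<prec>[u] a"
    unfolding subset_iff up_iff by blast
  from that[OF in_starI[OF this(1) via_restrict[OF this(2) assms(3)]] via_swap[OF this(2) assms(3)]]
  show thesis .
qed

lemma dense_star:
  assumes "dense X" shows "dense (X\<^sup>\<star>)"
proof
  fix s assume "s \<in> X\<^sup>\<star>"
  then obtain a b where "a \<in> X" "a \<prec>[s] b"
    by (auto simp: star_iff)
  then show "s \<in> X\<^sup>\<star>\<^sup>\<up>"
    using star_below[OF assms] in_upI by metis
qed

lemma atlas_dense: "atlas N Z A \<Longrightarrow> dense A"
  by (simp add: atlas_def)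

lemma atlas_triple: "atlas N Z A \<Longrightarrow> A * A\<^sup>\<star> * A \<subseteq> A"
  by (simp add: atlas_def)

lemma atlas_mult: "atlas N Z A \<Longrightarrow> a \<in> A \<Longrightarrow> s \<in> A\<^sup>\<star> \<Longrightarrow> b \<in> A \<Longrightarrow> a * (s * b) \<in> A"
  using atlas_triple[of A] set_times_intro[OF set_times_intro, of a A s "A\<^sup>\<star>" b A]
  by (auto simp: mult.assoc)

lemma coset_iff: "coset N Z C \<longleftrightarrow> atlas N Z C \<and> C\<^sup>\<up> = C"
  by (auto simp: coset_def atlas_def)

text \<open>If \<open>s \<prec>[v] t\<close> with \<open>s\<close> in the star, \<open>via_flip\<close> produces an element of \<open>A A\<^sup>\<star> A \<subseteq> A\<close> that \<open>t\<close> inverts.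
  The same element is dominated by \<open>v\<close>, which is the inclusion \<open>A\<^sup>\<star>\<^sup>\<star> \<subseteq> A\<^sup>\<up>\<close> below.\<close>

lemma up_star:
  assumes "atlas N Z A"
  shows "A\<^sup>\<star>\<^sup>\<up> = A\<^sup>\<star>"
proof
  show "A\<^sup>\<star>\<^sup>\<up> \<subseteq> A\<^sup>\<star>"
  proof
    fix t assume "t \<in> A\<^sup>\<star>\<^sup>\<up>"
    then obtain a s b v where a: "a \<in> A" "a \<prec>[s] b" "s \<prec>[v] t"
      by (auto simp: up_iff star_iff)
    have "a * ((s * (v * s)) * a) \<in> A"
      using atlas_mult[OF assms a(1) in_starI[OF a(1) via_flip_star[OF a(2,3)]] a(1)] .
    then show "t \<in> A\<^sup>\<star>"
      using in_starI[OF _ via_flip[OF a(2,3)]] by (simp add: mult.assoc)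
  qed
qed (rule dense_star[OF atlas_dense[OF assms]])

lemma star_star:
  assumes "atlas N Z A"
  shows "A\<^sup>\<star>\<^sup>\<star> = A\<^sup>\<up>"
proof
  show "A\<^sup>\<star>\<^sup>\<star> \<subseteq> A\<^sup>\<up>"
  proof
    fix v assume "v \<in> A\<^sup>\<star>\<^sup>\<star>"
    then obtain a s b t where a: "a \<in> A" "a \<prec>[s] b" "s \<prec>[v] t"
      by (auto simp: star_iff)
    have "a * ((s * (v * s)) * a) \<in> A"
      using atlas_mult[OF assms a(1) in_starI[OF a(1) via_flip_star[OF a(2,3)]] a(1)] .
    then show "v \<in> A\<^sup>\<up>"
      using in_upI[OF _ via_flip[OF a(2,3)]] by (simp add: mult.assoc)
  qed
  show "A\<^sup>\<up> \<subseteq> A\<^sup>\<star>\<^sup>\<star>"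
  proof
    fix b assume "b \<in> A\<^sup>\<up>"
    then obtain a s where "a \<in> A" "a \<prec>[s] b"
      by (auto simp: up_iff)
    then show "b \<in> A\<^sup>\<star>\<^sup>\<star>"
      using star_below[OF atlas_dense[OF assms]] in_starI by metis
  qed
qed

text \<open>For \<open>s, t \<in> A\<^sup>\<star>\<close> and \<open>b \<in> A\<^sup>\<star>\<^sup>\<star>\<close>, choose \<open>a, d \<in> A\<close> inverted by \<open>s, t\<close> and \<open>g \<in> A\<^sup>\<star>\<close> inverted by \<open>b\<close>;
  then \<open>d g a \<in> A\<close> is inverted by \<open>s b t\<close>.\<close>

lemma atlas_star:
  assumes A: "atlas N Z A"
  shows "atlas N Z (A\<^sup>\<star>)"
proof -
  have "s * b * t \<in> A\<^sup>\<star>" if st: "s \<in> A\<^sup>\<star>" "b \<in> A\<^sup>\<star>\<^sup>\<star>" "t \<in> A\<^sup>\<star>" for s b t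
  proof -
    from st obtain a c g h d e where
      *: "a \<in> A" "a \<prec>[s] c" "g \<in> A\<^sup>\<star>" "g \<prec>[b] h" "d \<in> A" "d \<prec>[t] e"
      unfolding star_iff[of _ "A\<^sup>\<star>"] star_iff[of s] star_iff[of t] by blast
    show ?thesis
      using in_starI[OF _ via_mult[OF via_mult[OF *(6,4)] *(2)]] atlas_mult[OF A *(5,3,1)]
      by (simp add: mult.assoc)
  qed
  then show ?thesis
    using dense_star[OF atlas_dense[OF A]] by (auto simp: atlas_def elim!: set_times_elim)
qed

lemma atlas_up:
  assumes A: "atlas N Z A"
  shows "atlas N Z (A\<^sup>\<up>)"
proof -
  note d = atlas_dense[OF A]
  have "A\<^sup>\<up> * A\<^sup>\<star> * A\<^sup>\<up> \<subseteq> (A * A\<^sup>\<star> * A)\<^sup>\<up>"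
    using up_times[of "A * A\<^sup>\<star>" A] set_times_mono2[OF up_times[of A "A\<^sup>\<star>"] order_refl, of "A\<^sup>\<up>"]
    unfolding up_star[OF A] by blast
  also have "\<dots> \<subseteq> A\<^sup>\<up>"
    using up_mono[OF atlas_triple[OF A]] .
  finally show ?thesis
    by (simp add: atlas_def star_up[OF d] up_idem[OF d])
qed

lemma coset_up: "atlas N Z A \<Longrightarrow> coset N Z (A\<^sup>\<up>)"
  by (simp add: coset_iff atlas_up up_idem[OF atlas_dense])

lemma coset_star: "atlas N Z A \<Longrightarrow> coset N Z (A\<^sup>\<star>)"
  by (simp add: coset_iff atlas_star up_star)

text \<open>Up to the closure \<open>\<up>\<close>, the inverse \<open>A\<^sup>\<star>\<close> is a generalised inverse of \<open>A\<close>.\<close>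

lemma up_atlas_triple:
  assumes "atlas N Z A"
  shows "(A * A\<^sup>\<star> * A)\<^sup>\<up> = A\<^sup>\<up>"
proof
  show "A\<^sup>\<up> \<subseteq> (A * A\<^sup>\<star> * A)\<^sup>\<up>"
  proof (rule up_subsetI, rule subsetI)
    fix c assume c: "c \<in> A"
    then obtain a s where a: "a \<in> A" "a \<prec>[s] c"
      using subsetD[OF atlas_dense[OF assms] c] by (auto simp: up_iff)
    then have "a * s * c \<in> A * A\<^sup>\<star> * A"
      using c in_starI by blast
    with a show "c \<in> (A * A\<^sup>\<star> * A)\<^sup>\<up>"
      by (auto simp: up_iff mult.assoc viaD)
  qed
qed (use up_mono[OF atlas_triple[OF assms]] in blast)

lemma src_eq: "src A = (A\<^sup>\<star> * A)\<^sup>\<up>"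
  by (simp add: atlas_source_def)

lemma rng_eq: "rng A = (A * A\<^sup>\<star>)\<^sup>\<up>"
  by (simp add: atlas_range_def)

lemma dense_star_times: "atlas N Z A \<Longrightarrow> dense (A\<^sup>\<star> * A)"
  by (simp add: atlas_dense dense_star dense_times)

lemma dense_times_star: "atlas N Z A \<Longrightarrow> dense (A * A\<^sup>\<star>)"
  by (simp add: atlas_dense dense_star dense_times)

lemma src_up: "atlas N Z A \<Longrightarrow> src (A\<^sup>\<up>) = src A"
  using up_times_cong[of "A\<^sup>\<star>" "A\<^sup>\<star>" "A\<^sup>\<up>" A]
  by (simp add: src_eq star_up atlas_dense dense_star up_idem)

lemma rng_up: "atlas N Z A \<Longrightarrow> rng (A\<^sup>\<up>) = rng A"
  using up_times_cong[of "A\<^sup>\<up>" A "A\<^sup>\<star>" "A\<^sup>\<star>"]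
  by (simp add: rng_eq star_up atlas_dense dense_star up_idem)

lemma src_star: "atlas N Z A \<Longrightarrow> src (A\<^sup>\<star>) = rng A"
  using up_times_cong[of "A\<^sup>\<up>" A "A\<^sup>\<star>" "A\<^sup>\<star>"]
  by (simp add: rng_eq src_eq star_star atlas_dense dense_star up_idem)

lemma rng_star: "atlas N Z A \<Longrightarrow> rng (A\<^sup>\<star>) = src A"
  using up_times_cong[of "A\<^sup>\<star>" "A\<^sup>\<star>" "A\<^sup>\<up>" A]
  by (simp add: rng_eq src_eq star_star atlas_dense dense_star up_idem)

lemma star_triple:
  assumes A: "atlas N Z A"
  shows "(A\<^sup>\<star> * A * A\<^sup>\<star>)\<^sup>\<up> = A\<^sup>\<star>"
proof -
  note d = atlas_dense[OF A] dense_star[OF atlas_dense[OF A]]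
  have "(A\<^sup>\<star> * A * A\<^sup>\<star>)\<^sup>\<up> = (A\<^sup>\<star> * A\<^sup>\<up> * A\<^sup>\<star>)\<^sup>\<up>"
    by (intro up_times_cong dense_times dense_up d refl) (simp add: up_idem d)
  then show ?thesis
    using up_atlas_triple[OF atlas_star[OF A]] by (simp add: star_star up_star A)
qed

lemma up_mult_src: "atlas N Z A \<Longrightarrow> (A * src A)\<^sup>\<up> = A\<^sup>\<up>"
  using up_times_cong[of A A "src A" "A\<^sup>\<star> * A"] up_atlas_triple[of A] dense_star_times[of A]
  by (simp add: src_eq atlas_dense up_idem mult.assoc)

lemma up_rng_mult: "atlas N Z A \<Longrightarrow> (rng A * A)\<^sup>\<up> = A\<^sup>\<up>"
  using up_times_cong[of "rng A" "A * A\<^sup>\<star>" A A] up_atlas_triple[of A] dense_times_star[of A]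
  by (simp add: rng_eq atlas_dense up_idem mult.assoc)

lemma dense_src: "atlas N Z A \<Longrightarrow> dense (src A)"
  by (simp add: src_eq dense_star_times up_idem)

lemma dense_rng: "atlas N Z A \<Longrightarrow> dense (rng A)"
  by (simp add: rng_eq dense_times_star up_idem)

lemma mult_src_subset: "atlas N Z A \<Longrightarrow> A\<^sup>\<up> * src A \<subseteq> A\<^sup>\<up>"
  using up_times[of A "src A"] up_mult_src[of A] dense_src[of A] up_idem[OF dense_star_times, of A]
  by (simp add: src_eq)

lemma rng_mult_subset: "atlas N Z A \<Longrightarrow> rng A * A\<^sup>\<up> \<subseteq> A\<^sup>\<up>"
  using up_times[of "rng A" A] up_rng_mult[of A] dense_rng[of A] up_idem[OF dense_times_star, of A]
  by (simp add: rng_eq)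

lemma src_mult_star_subset: "atlas N Z A \<Longrightarrow> src A * A\<^sup>\<star> \<subseteq> A\<^sup>\<star>"
  using rng_mult_subset[OF atlas_star, of A] by (simp add: rng_star up_star)

lemma star_mult_rng_subset: "atlas N Z A \<Longrightarrow> A\<^sup>\<star> * rng A \<subseteq> A\<^sup>\<star>"
  using mult_src_subset[OF atlas_star, of A] by (simp add: src_star up_star)

lemma star_times_star_subset: "B\<^sup>\<star> * A\<^sup>\<star> \<subseteq> (A * B)\<^sup>\<star>"
proof
  fix x assume "x \<in> B\<^sup>\<star> * A\<^sup>\<star>"
  then obtain t s a b c d where "x = t * s" "a \<in> A" "a \<prec>[s] b" "c \<in> B" "c \<prec>[t] d"
    by (auto simp: star_iff elim!: set_times_elim)
  then show "x \<in> (A * B)\<^sup>\<star>"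
    using in_starI[OF set_times_intro via_mult] by simp
qed


section \<open>Products of atlases\<close>

context
  fixes A B
  assumes A: "atlas N Z A" and B: "atlas N Z B" and AB: "src A = rng B"
begin

text \<open>Given \<open>s\<close> inverting something above \<open>a b\<close>, \<open>via_quot_right\<close> puts \<open>b s\<close> into \<open>A\<^sup>\<star>\<close>; the condition
  \<open>src A = rng B\<close> enters to absorb the restriction \<open>b' q \<in> rng B\<close> into \<open>A\<close>.  Then \<open>s\<close> dominates
  \<open>q (p a (b s))\<close>, whose factors are \<open>q \<in> B\<^sup>\<star>\<close> and \<open>p a (b s) \<in> A\<^sup>\<star> A A\<^sup>\<star>\<close>.\<close>

lemma star_prod_subset: "(A * B)\<^sup>\<star> \<subseteq> (B\<^sup>\<star> * A\<^sup>\<star>)\<^sup>\<up>"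
proof
  fix s assume "s \<in> (A * B)\<^sup>\<star>"
  then obtain a b d where a: "a \<in> A" and b: "b \<in> B" and s: "a * b \<prec>[s] d"
    by (auto simp: star_iff elim!: set_times_elim)
  obtain a' p where a': "a' \<in> A" "a' \<prec>[p] a"
    using subsetD[OF atlas_dense[OF A] a] by (auto simp: up_iff)
  obtain b' q where b': "b' \<in> B" "b' \<prec>[q] b"
    using subsetD[OF atlas_dense[OF B] b] by (auto simp: up_iff)
  have "b' * q \<in> src A"
    unfolding AB rng_eq
    using subsetD[OF dense_times_star[OF B] set_times_intro[OF b'(1) in_starI[OF b']]] .
  then have "a * (b' * q) \<in> A\<^sup>\<up>"
    using mult_src_subset[OF A] subsetD[OF atlas_dense[OF A] a] by blast
  then have "b * s \<in> A\<^sup>\<star>"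
    using in_starI[OF _ via_quot_right[OF s b'(2)], of "A\<^sup>\<up>"] star_up[OF atlas_dense[OF A]] by simp
  then have "p * (a * (b * s)) \<in> A\<^sup>\<star>"
    using atlas_mult[OF atlas_star[OF A], of p a "b * s"] in_starI[OF a'] a
      subsetD[OF atlas_dense[OF A] a] by (simp add: star_star A)
  then have "q * (p * (a * (b * s))) \<in> B\<^sup>\<star> * A\<^sup>\<star>"
    using in_starI[OF b'] by blast
  then show "s \<in> (B\<^sup>\<star> * A\<^sup>\<star>)\<^sup>\<up>"
    using in_upI[OF _ via_swap[OF via_mult[OF a'(2) b'(2)] s]] by (simp add: mult.assoc)
qed

text \<open>The inclusion holds for every element of \<open>B\<close>, whereas the quotient argument only treats the
  factor \<open>b\<close> belonging to \<open>s\<close>.  It is what makes \<open>A * B\<close> itself, and not just its up-closure, absorb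
  its triple product.\<close>

lemma mult_star_prod_subset: "B * (A * B)\<^sup>\<star> \<subseteq> A\<^sup>\<star>"
proof -
  have "B * (A * B)\<^sup>\<star> \<subseteq> B\<^sup>\<up> * (B\<^sup>\<star> * A\<^sup>\<star>)\<^sup>\<up>"
    by (intro set_times_mono2 atlas_dense[OF B] star_prod_subset)
  also have "\<dots> \<subseteq> (B * (B\<^sup>\<star> * A\<^sup>\<star>))\<^sup>\<up>"
    by (rule up_times)
  also have "\<dots> \<subseteq> (src A * A\<^sup>\<star>)\<^sup>\<up>"
    unfolding AB rng_eq mult.assoc[symmetric]
    by (intro up_mono set_times_mono2 dense_times_star[OF B] order_refl)
  also have "\<dots> \<subseteq> A\<^sup>\<star>"
    using up_mono[OF src_mult_star_subset[OF A]] by (simp add: up_star[OF A])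
  finally show ?thesis .
qed

lemma atlas_prod: "atlas N Z (A * B)"
proof -
  have "(A * B) * (A * B)\<^sup>\<star> * (A * B) = A * (B * (A * B)\<^sup>\<star>) * A * B"
    by (simp add: mult.assoc)
  also have "\<dots> \<subseteq> A * A\<^sup>\<star> * A * B"
    by (intro set_times_mono2 mult_star_prod_subset order_refl)
  also have "\<dots> \<subseteq> A * B"
    by (intro set_times_mono2 atlas_triple[OF A] order_refl)
  finally show ?thesis
    using dense_times[OF atlas_dense[OF A] atlas_dense[OF B]] by (simp add: atlas_def)
qed

lemma star_prod: "(A * B)\<^sup>\<star> = (B\<^sup>\<star> * A\<^sup>\<star>)\<^sup>\<up>"
  using star_prod_subset up_mono[OF star_times_star_subset[of B A]] up_star[OF atlas_prod] by auto

lemma src_prod: "src (A * B) = src B"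
proof -
  note d = atlas_dense[OF A] atlas_dense[OF B] dense_star[OF atlas_dense[OF A]]
    dense_star[OF atlas_dense[OF B]] dense_src[OF A] dense_star_times[OF A] dense_times_star[OF B]
  have "src (A * B) = ((B\<^sup>\<star> * A\<^sup>\<star>) * (A * B))\<^sup>\<up>"
    unfolding src_eq star_prod
    by (intro up_times_cong dense_times dense_up d refl) (simp add: up_idem dense_times d)
  also have "\<dots> = (B\<^sup>\<star> * ((A\<^sup>\<star> * A) * B))\<^sup>\<up>"
    by (simp add: mult.assoc)
  also have "\<dots> = (B\<^sup>\<star> * ((B * B\<^sup>\<star>) * B))\<^sup>\<up>"
    by (intro up_times_cong[OF d(4) d(4) refl] up_times_cong[OF d(6,7) _ d(2) d(2) refl] dense_times d)
      (use AB in \<open>simp add: src_eq rng_eq\<close>)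
  also have "\<dots> = ((B\<^sup>\<star> * B * B\<^sup>\<star>) * B)\<^sup>\<up>"
    by (simp add: mult.assoc)
  also have "\<dots> = (B\<^sup>\<star> * B)\<^sup>\<up>"
    by (intro up_times_cong dense_times d refl) (simp add: star_triple up_star B)
  finally show ?thesis by (simp add: src_eq)
qed

lemma rng_prod: "rng (A * B) = rng A"
proof -
  note d = atlas_dense[OF A] atlas_dense[OF B] dense_star[OF atlas_dense[OF A]]
    dense_star[OF atlas_dense[OF B]] dense_src[OF A] dense_star_times[OF A] dense_times_star[OF B]
  have "rng (A * B) = ((A * B) * (B\<^sup>\<star> * A\<^sup>\<star>))\<^sup>\<up>"
    unfolding rng_eq star_prod
    by (intro up_times_cong dense_times dense_up d refl) (simp add: up_idem dense_times d)
  also have "\<dots> = (A * ((B * B\<^sup>\<star>) * A\<^sup>\<star>))\<^sup>\<up>"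
    by (simp add: mult.assoc)
  also have "\<dots> = (A * ((A\<^sup>\<star> * A) * A\<^sup>\<star>))\<^sup>\<up>"
    by (intro up_times_cong[OF d(1) d(1) refl] up_times_cong[OF d(7,6) _ d(3) d(3) refl] dense_times d)
      (use AB in \<open>simp add: src_eq rng_eq\<close>)
  also have "\<dots> = (A * A\<^sup>\<star>)\<^sup>\<up>"
    by (intro up_times_cong dense_times d refl) (simp add: star_triple up_star A)
  finally show ?thesis by (simp add: rng_eq)
qed

end


section \<open>The groupoid of cosets\<close>

lemma cosetsD:
  assumes "C \<in> cosets N Z"
  shows "atlas N Z C" "C\<^sup>\<up> = C" "dense C" "C\<^sup>\<star>\<^sup>\<up> = C\<^sup>\<star>" "C\<^sup>\<star>\<^sup>\<star> = C" "C \<noteq> {}"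
  using assms by (auto simp: cosets_def coset_iff up_star star_star)

lemma coset_below:
  assumes "C \<in> cosets N Z" "c \<in> C"
  obtains a s where "a \<in> C" "s \<in> C\<^sup>\<star>" "a \<prec>[s] c"
proof -
  from assms have "c \<in> C\<^sup>\<up>" using cosetsD by blast
  with that show thesis by (auto simp: up_iff intro: in_starI)
qed

lemma up_in_cosets: "atlas N Z A \<Longrightarrow> A \<noteq> {} \<Longrightarrow> A\<^sup>\<up> \<in> cosets N Z"
  using atlas_dense[of A] coset_up[of A] by (auto simp: cosets_def)

lemma star_in_cosets:
  assumes "C \<in> cosets N Z" shows "C\<^sup>\<star> \<in> cosets N Z"
proof -
  obtain c where "c \<in> C" using cosetsD(6)[OF assms] by blast
  then have "C\<^sup>\<star> \<noteq> {}" using coset_below[OF assms] by blast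
  then show ?thesis
    using coset_star[OF cosetsD(1)[OF assms]] by (simp add: cosets_def)
qed

lemma prod_in_cosets:
  assumes "B \<in> cosets N Z" "C \<in> cosets N Z" "src B = rng C"
  shows "(B * C)\<^sup>\<up> \<in> cosets N Z"
proof (rule up_in_cosets)
  show "atlas N Z (B * C)"
    using atlas_prod cosetsD assms by blast
  show "B * C \<noteq> {}"
    using cosetsD(6) assms by (metis ex_in_conv set_times_intro)
qed

lemma src_prod_coset:
  assumes "B \<in> cosets N Z" "C \<in> cosets N Z" "src B = rng C"
  shows "src ((B * C)\<^sup>\<up>) = src C" "rng ((B * C)\<^sup>\<up>) = rng B"
  using assms by (simp_all add: cosetsD src_up rng_up src_prod rng_prod atlas_prod)

lemma src_in_cosets: "C \<in> cosets N Z \<Longrightarrow> src C \<in> cosets N Z"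
  using prod_in_cosets[OF star_in_cosets, of C C] by (simp add: src_eq[symmetric] src_star cosetsD)

lemma rng_in_cosets: "C \<in> cosets N Z \<Longrightarrow> rng C \<in> cosets N Z"
  using prod_in_cosets[OF _ star_in_cosets, of C C] by (simp add: rng_eq[symmetric] rng_star cosetsD)

lemma src_idem:
  assumes "C \<in> cosets N Z" shows "src (src C) = src C" "rng (src C) = src C"
  using src_prod_coset[OF star_in_cosets[OF assms] assms] cosetsD(1)[OF assms]
  by (simp_all add: src_star rng_star src_eq[symmetric])

lemma rng_idem:
  assumes "C \<in> cosets N Z" shows "src (rng C) = rng C" "rng (rng C) = rng C"
  using src_prod_coset[OF assms star_in_cosets[OF assms]] cosetsD(1)[OF assms]
  by (simp_all add: src_star rng_star rng_eq[symmetric])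

lemma prod_coset_assoc:
  assumes "B \<in> cosets N Z" "C \<in> cosets N Z" "D \<in> cosets N Z"
  shows "((B * C)\<^sup>\<up> * D)\<^sup>\<up> = (B * (C * D)\<^sup>\<up>)\<^sup>\<up>"
proof -
  note d = cosetsD(3)[OF assms(1)] cosetsD(3)[OF assms(2)] cosetsD(3)[OF assms(3)]
  have "((B * C)\<^sup>\<up> * D)\<^sup>\<up> = ((B * C) * D)\<^sup>\<up>"
    by (intro up_times_cong dense_times dense_up d refl) (simp add: up_idem dense_times d)
  moreover have "(B * (C * D)\<^sup>\<up>)\<^sup>\<up> = (B * (C * D))\<^sup>\<up>"
    by (intro up_times_cong dense_times dense_up d refl) (simp add: up_idem dense_times d)
  ultimately show ?thesis by (simp add: mult.assoc)
qed

lemma prod_coset_cancel: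
  assumes "B \<in> cosets N Z" "C \<in> cosets N Z" "src B = rng C"
  shows "(B\<^sup>\<star> * (B * C)\<^sup>\<up>)\<^sup>\<up> = C" "((B * C)\<^sup>\<up> * C\<^sup>\<star>)\<^sup>\<up> = B"
proof -
  show "(B\<^sup>\<star> * (B * C)\<^sup>\<up>)\<^sup>\<up> = C"
    using prod_coset_assoc[OF star_in_cosets[OF assms(1)] assms(1,2)] up_rng_mult[of C] assms
    by (simp add: src_eq[symmetric] cosetsD)
  show "((B * C)\<^sup>\<up> * C\<^sup>\<star>)\<^sup>\<up> = B"
    using prod_coset_assoc[OF assms(1,2) star_in_cosets[OF assms(2)]] up_mult_src[of B] assms
    by (simp add: rng_eq[symmetric] cosetsD)
qed

abbreviation CG :: "'a set top_groupoid" where "CG \<equiv> coset_groupoid N Z"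

lemma CG_simps [simp]:
  "arrows CG = cosets N Z"
  "(B, C) \<in> composable CG \<longleftrightarrow> B \<in> cosets N Z \<and> C \<in> cosets N Z \<and> src B = rng C"
  "gmult CG B C = (B * C)\<^sup>\<up>"
  "ginv CG C = C\<^sup>\<star>"
  "gsource CG C = src C"
  by (simp_all add: coset_groupoid_def gsource_def src_eq)

lemma groupoid_CG: "groupoid CG"
  unfolding groupoid_def
proof (intro conjI allI ballI impI)
  show "composable CG \<subseteq> arrows CG \<times> arrows CG"
    by auto
next
  fix B C assume BC: "(B, C) \<in> composable CG"
  then show "gmult CG B C \<in> arrows CG"
    by (simp add: prod_in_cosets)
  show "gmult CG (ginv CG B) (gmult CG B C) = C" "gmult CG (gmult CG B C) (ginv CG C) = B"
    using BC prod_coset_cancel[of B C] by simp_all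
next
  fix B C D assume BCD: "(B, C) \<in> composable CG \<and> (C, D) \<in> composable CG"
  then show "gmult CG (gmult CG B C) D = gmult CG B (gmult CG C D)"
    by (simp add: prod_coset_assoc)
  show "(gmult CG B C, D) \<in> composable CG" "(B, gmult CG C D) \<in> composable CG"
    using BCD by (simp_all add: prod_in_cosets src_prod_coset)
next
  fix C assume C: "C \<in> arrows CG"
  then show "ginv CG C \<in> arrows CG" "ginv CG (ginv CG C) = C"
    by (simp_all add: star_in_cosets cosetsD)
  show "(C, ginv CG C) \<in> composable CG" "(ginv CG C, C) \<in> composable CG"
    using C by (simp_all add: star_in_cosets cosetsD src_star rng_star)
qed

text \<open>Multiplying by \<open>z \<in> D \<inter> D\<^sup>\<star>\<close> goes down in the order and moves elements between \<open>D\<close>, \<open>D * D\<close> and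
  \<open>D\<^sup>\<star>\<close>: for instance \<open>z s' z \<in> D\<close> for \<open>s' \<in> D\<^sup>\<star>\<close>, and \<open>z s' z\<close> is dominated by every \<open>s\<close> that
  dominates \<open>s'\<close>.\<close>

lemma unit_coset:
  assumes D: "D \<in> cosets N Z" and n: "n \<in> D" "n \<prec>[z] z" and z: "z \<in> Z"
  shows "D\<^sup>\<star> = D" "D * D \<subseteq> D" "src D = D"
proof -
  have zs: "z \<in> D\<^sup>\<star>" using in_starI[OF n] .
  have zD: "z \<in> D" using in_upI[OF n] cosetsD[OF D] by simp
  have zN: "z \<in> N" using z by (rule Z_N)
  have upD: "b \<in> D" if "a \<in> D" "a \<prec>[s] b" for a b s
    using in_upI[OF that] cosetsD[OF D] by simp
  show DD: "D * D \<subseteq> D"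
  proof (rule subsetI, erule set_times_elim)
    fix x d e assume x: "x = d * e" "d \<in> D" "e \<in> D"
    obtain d' r where d': "d' \<in> D" "d' \<prec>[r] d" using coset_below[OF D x(2)] .
    obtain e' t where e': "e' \<in> D" "e' \<prec>[t] e" using coset_below[OF D x(3)] .
    show "x \<in> D"
      using upD[OF atlas_mult[OF cosetsD(1)[OF D] d'(1) zs e'(1)]
          via_mult[OF d'(2) via_N_left[OF zN e'(2)]]] x by simp
  qed
  show DS: "D\<^sup>\<star> = D"
  proof
    show "D\<^sup>\<star> \<subseteq> D"
    proof
      fix s assume "s \<in> D\<^sup>\<star>"
      then obtain s' v where s': "s' \<in> D\<^sup>\<star>" "s' \<prec>[v] s"
        using coset_below[OF star_in_cosets[OF D]] by metis
      show "s \<in> D"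
        using upD[OF atlas_mult[OF cosetsD(1)[OF D] zD s'(1) zD]]
          via_N_left[OF zN via_N_right[OF zN s'(2)]] by blast
    qed
    show "D \<subseteq> D\<^sup>\<star>"
    proof
      fix d assume "d \<in> D"
      then obtain d' r where d': "d' \<in> D" "d' \<prec>[r] d"
        using coset_below[OF D] by metis
      have "z * (d' * z) \<in> D\<^sup>\<star>"
        using atlas_mult[OF atlas_star[OF cosetsD(1)[OF D]] zs _ zs] d'(1) cosetsD(5)[OF D] by simp
      then show "d \<in> D\<^sup>\<star>"
  using in_upI[OF _ via_N_left[OF zN via_N_right[OF zN d'(2)]], of "D\<^sup>\<star>"] cosetsD(4)[OF D] by simp
    qed
  qed
  have "D \<subseteq> (D * D)\<^sup>\<up>"
  proof
    fix d assume "d \<in> D"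
    then obtain d' r where d': "d' \<in> D" "d' \<prec>[r] d"
      using coset_below[OF D] by metis
    show "d \<in> (D * D)\<^sup>\<up>"
      using in_upI[OF set_times_intro[OF d'(1) zD] via_N_right[OF zN d'(2)]] .
  qed
  then show "src D = D"
    using up_mono[OF DD] cosetsD[OF D] unfolding src_eq DS by blast
qed

text \<open>With \<open>unit_coset\<close>: every coset containing some \<open>v a'\<close> with \<open>a' \<prec>[v] a\<close> is a unit, so the units
  form an open set.\<close>

lemma via_unit:
  assumes "a' \<prec>[v] a" shows "v * a' \<prec>[v * a] v * a"
proof (rule viaI)
  note V = viaD[OF assms]
  show "v * a' * (v * a * (v * a)) = v * a'" "v * a * (v * a * (v * a')) = v * a'"
    by (simp_all add: mult.assoc V)
  show "v * a' * (v * a) \<in> N" "v * a * (v * a') \<in> N"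
    by (rule N_mult V(4) Z_N V(6))+
  show "v * a * (v * a) \<in> Z" "v * a * (v * a) \<in> Z"
    by (rule Z_mult V(6))+
qed

text \<open>A local inverse of the source map.  The relation \<open>v a' \<in> D\<close> says that \<open>D\<close> meets the domain on which
  \<open>a\<close> is inverted by \<open>v\<close>; multiplication by \<open>a\<close> then transports the unit \<open>D\<close> to a coset with source \<open>D\<close>.\<close>

lemma translate_unit:
  assumes D: "D \<in> cosets N Z" and a: "a' \<prec>[v] a" "v * a' \<in> D"
  shows "atlas N Z ({a} * D)" "src ({a} * D) = D"
proof -
  let ?E = "{a} * D"
  note U = unit_coset[OF D a(2) via_unit[OF a(1)] viaD(6)[OF a(1)]]
  note V = viaD[OF a(1)]
  have DD: "x * y \<in> D" if "x \<in> D" "y \<in> D" for x y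
    using U(2) that by blast
  have E: "a * d \<in> ?E" if "d \<in> D" for d
    using that by (intro set_times_intro) auto
  have E': "a' * d \<in> ?E" if "d \<in> D" for d
    using E[OF DD[OF a(2) that]] by (simp add: mult.assoc V)
  have S: "s * a \<in> D" if s: "s \<in> ?E\<^sup>\<star>" for s
  proof -
    from s obtain d y where "d \<in> D" "a * d \<prec>[s] y"
      by (auto simp: star_iff elim!: set_times_elim)
    then show ?thesis
      using in_starI[OF _ via_quot_left[OF _ a(1)], of d D] DD[OF a(2)] U(1) by (simp add: mult.assoc)
  qed
  show atl: "atlas N Z ?E"
  proof -
    have "?E \<subseteq> ?E\<^sup>\<up>"
    proof (rule subsetI, erule set_times_elim)
      fix x b d assume x: "x = b * d" "b \<in> {a}" "d \<in> D"
      obtain d' r where d': "d' \<in> D" "d' \<prec>[r] d" using coset_below[OF D x(3)] .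
      show "x \<in> ?E\<^sup>\<up>"
        using in_upI[OF E'[OF d'(1)] via_mult[OF a(1) d'(2)]] x by simp
    qed
    moreover have "a * d * s * (a * e) \<in> ?E" if "d \<in> D" "s \<in> ?E\<^sup>\<star>" "e \<in> D" for d s e
      using E[OF DD[OF that(1) DD[OF S[OF that(2)] that(3)]]] by (simp add: mult.assoc)
    ultimately show ?thesis
      by (auto simp: atlas_def elim!: set_times_elim)
  qed
  have "?E\<^sup>\<star> * ?E \<subseteq> D"
  proof
    fix x assume "x \<in> ?E\<^sup>\<star> * ?E"
    then obtain s d where "x = s * (a * d)" "s \<in> ?E\<^sup>\<star>" "d \<in> D"
      by (auto elim!: set_times_elim)
    then show "x \<in> D" using DD[OF S] by (simp add: mult.assoc)
  qed
  moreover have "D \<subseteq> (?E\<^sup>\<star> * ?E)\<^sup>\<up>"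
  proof
    fix d assume "d \<in> D"
    then obtain d' t where d': "d' \<in> D" "d' \<prec>[t] d"
      using coset_below[OF D] by metis
    then obtain e f where e: "e \<in> D" "e \<prec>[d'] f"
      using star_iff[of d' D] unfolding U(1) by auto
    have "d' * v \<in> ?E\<^sup>\<star>"
      using in_starI[OF E'[OF e(1)] via_mult[OF a(1) e(2)]] .
    then have "(d' * v) * (a * (v * a')) \<in> ?E\<^sup>\<star> * ?E"
      using E[OF a(2)] by (rule set_times_intro)
    then show "d \<in> (?E\<^sup>\<star> * ?E)\<^sup>\<up>"
      using in_upI[OF _ via_N_right[OF V(4) d'(2)]] by (simp add: mult.assoc V)
  qed
  ultimately show "src ?E = D"
    using up_mono cosetsD(2)[OF D] unfolding src_eq by blast
qed

text \<open>The sets of all cosets containing a given finite subset of \<open>C\<close> form a neighbourhood base at \<open>C\<close>.\<close>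

lemma openin_CG_iff:
  "openin (gtop CG) U \<longleftrightarrow>
     U \<subseteq> cosets N Z \<and>
     (\<forall>C\<in>U. \<exists>F. finite F \<and> F \<subseteq> C \<and> (\<forall>D\<in>cosets N Z. F \<subseteq> D \<longrightarrow> D \<in> U))"
  (is "_ \<longleftrightarrow> ?R")
proof -
  let ?n = "\<lambda>a. {C \<in> cosets N Z. a \<in> C}"
  have S: "{?n a |a. True} = range ?n" by auto
  have top: "gtop CG = topology_generated_by (range ?n)"
    unfolding S[symmetric] by (simp add: coset_groupoid_def)
  have inter: "\<Inter>(?n ` G) = {C \<in> cosets N Z. G \<subseteq> C}" if "G \<noteq> {}" for G
    using that by auto
  show ?thesis
  proof
    assume L: "openin (gtop CG) U"
    have "C \<in> cosets N Z \<and> (\<exists>F. finite F \<and> F \<subseteq> C \<and> (\<forall>D\<in>cosets N Z. F \<subseteq> D \<longrightarrow> D \<in> U))"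
      if C: "C \<in> U" for C
    proof -
      obtain F where F: "finite F" "F \<noteq> {}" "F \<subseteq> range ?n" "C \<in> \<Inter>F" "\<Inter>F \<subseteq> U"
        using bspec[OF L[unfolded top openin_generated_iff] C] by (elim exE conjE)
      obtain G where G: "finite G" "F = ?n ` G"
        using finite_subset_image[OF F(1) F(3)] by auto
      then have "G \<noteq> {}" using F(2) by auto
      with F(4,5) show ?thesis
        using G(1) unfolding G(2) inter[OF \<open>G \<noteq> {}\<close>] by (intro conjI exI[of _ G]) auto
    qed
    then show ?R by (intro conjI subsetI ballI) simp_all
  next
    assume R: ?R
    show "openin (gtop CG) U"
      unfolding top openin_generated_iff
    proof
      fix C assume C: "C \<in> U"
      then have CC: "C \<in> cosets N Z" using R by auto
      then obtain c where c: "c \<in> C" using cosetsD(6) by blast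
      obtain F where F: "finite F" "F \<subseteq> C" "\<forall>D\<in>cosets N Z. F \<subseteq> D \<longrightarrow> D \<in> U"
        using bspec[OF conjunct2[OF R] C] by (elim exE conjE)
      show "\<exists>F. finite F \<and> F \<noteq> {} \<and> F \<subseteq> range ?n \<and> C \<in> \<Inter>F \<and> \<Inter>F \<subseteq> U"
      proof (intro exI conjI)
        \<comment> \<open>The element \<open>c\<close> of \<open>C\<close> keeps the intersection of basic sets inside the space when \<open>F\<close> is empty.\<close>
        show "finite (?n ` insert c F)" "?n ` insert c F \<noteq> {}" "?n ` insert c F \<subseteq> range ?n"
          using F(1) by auto
        show "C \<in> \<Inter>(?n ` insert c F)" "\<Inter>(?n ` insert c F) \<subseteq> U"
          using F(2,3) c CC inter[of "insert c F"] by auto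
      qed
    qed
  qed
qed

lemma openin_CG_D:
  assumes "openin (gtop CG) U" "C \<in> U"
  obtains F where "finite F" "F \<subseteq> C" "\<forall>D\<in>cosets N Z. F \<subseteq> D \<longrightarrow> D \<in> U"
proof -
  have "\<exists>F. finite F \<and> F \<subseteq> C \<and> (\<forall>D\<in>cosets N Z. F \<subseteq> D \<longrightarrow> D \<in> U)"
    using assms(1) unfolding openin_CG_iff by (elim conjE) (erule bspec[OF _ assms(2)])
  then show thesis using that by (elim exE conjE)
qed

lemma openin_CG_nbhd: "finite F \<Longrightarrow> openin (gtop CG) {C \<in> cosets N Z. F \<subseteq> C}"
  unfolding openin_CG_iff by (intro conjI ballI exI[of _ F]) auto

lemma topspace_CG [simp]: "topspace (gtop CG) = cosets N Z"
proof
  show "topspace (gtop CG) \<subseteq> cosets N Z"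
    using openin_topspace[of "gtop CG"] unfolding openin_CG_iff by simp
  show "cosets N Z \<subseteq> topspace (gtop CG)"
    using openin_subset[OF openin_CG_nbhd[of "{}"]] by simp
qed

lemma finite_choice:
  assumes "finite F" "\<And>f. f \<in> F \<Longrightarrow> \<exists>x\<in>C. P f x"
  obtains G where "finite G" "G \<subseteq> C" "\<forall>f\<in>F. \<exists>x\<in>G. P f x"
proof -
  obtain g where "\<forall>f\<in>F. g f \<in> C \<and> P f (g f)"
    using assms(2) by metis
  with that[of "g ` F"] assms(1) show thesis by blast
qed

lemma continuous_star: "continuous_map (gtop CG) (gtop CG) (ginv CG)"
proof -
  have "\<exists>F. finite F \<and> F \<subseteq> C \<and> (\<forall>D\<in>cosets N Z. F \<subseteq> D \<longrightarrow> D \<in> cosets N Z \<and> D\<^sup>\<star> \<in> U)"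
    if U: "openin (gtop CG) U" and C: "C \<in> cosets N Z" "C\<^sup>\<star> \<in> U" for U C
  proof -
    obtain F where F: "finite F" "F \<subseteq> C\<^sup>\<star>" "\<forall>D\<in>cosets N Z. F \<subseteq> D \<longrightarrow> D \<in> U"
      using openin_CG_D[OF U C(2)] .
    have "\<exists>c\<in>C. \<exists>b. c \<prec>[f] b" if "f \<in> F" for f
      using F(2) that by (auto simp: star_iff)
    from finite_choice[of F C, OF F(1) this] obtain G
      where G: "finite G" "G \<subseteq> C" "\<forall>f\<in>F. \<exists>c\<in>G. \<exists>b. c \<prec>[f] b" .
    have "D\<^sup>\<star> \<in> U" if D: "D \<in> cosets N Z" "G \<subseteq> D" for D
    proof -
      have "F \<subseteq> D\<^sup>\<star>"
      proof
        fix f assume "f \<in> F"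
        with G(3) obtain c b where "c \<in> G" "c \<prec>[f] b" by blast
        then show "f \<in> D\<^sup>\<star>" using D(2) in_starI by blast
      qed
      then show ?thesis using F(3) star_in_cosets[OF D(1)] by blast
    qed
    with G show ?thesis by blast
  qed
  then show ?thesis
    by (auto simp: continuous_map_def star_in_cosets openin_CG_iff[of "{x \<in> cosets N Z. _ x}"])
qed

lemma up_timesE:
  assumes "F \<subseteq> (B * C)\<^sup>\<up>"
  obtains b c where "\<forall>f\<in>F. b f \<in> B \<and> c f \<in> C \<and> (\<exists>s. b f * c f \<prec>[s] f)"
proof -
  have "\<forall>f\<in>F. \<exists>b c. b \<in> B \<and> c \<in> C \<and> (\<exists>s. b * c \<prec>[s] f)"
  proof
    fix f assume "f \<in> F"
    then have "f \<in> (B * C)\<^sup>\<up>" using assms by blast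
    then show "\<exists>b c. b \<in> B \<and> c \<in> C \<and> (\<exists>s. b * c \<prec>[s] f)"
      by (auto simp: up_iff elim!: set_times_elim)
  qed
  then show thesis using that by metis
qed

lemma continuous_prod:
  "continuous_map (subtopology (prod_topology (gtop CG) (gtop CG)) (composable CG)) (gtop CG)
     (\<lambda>(B, C). gmult CG B C)"
proof (rule continuous_map_prod_subI)
  show "composable CG \<subseteq> topspace (gtop CG) \<times> topspace (gtop CG)"
    by auto
  fix B C assume BC: "(B, C) \<in> composable CG"
  then show "gmult CG B C \<in> topspace (gtop CG)"
    by (simp add: prod_in_cosets)
  fix U assume U: "openin (gtop CG) U" "gmult CG B C \<in> U"
  then obtain F where F: "finite F" "F \<subseteq> (B * C)\<^sup>\<up>" "\<forall>D\<in>cosets N Z. F \<subseteq> D \<longrightarrow> D \<in> U"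
    using openin_CG_D[of U] by (metis CG_simps(3))
  obtain b c where bc: "\<forall>f\<in>F. b f \<in> B \<and> c f \<in> C \<and> (\<exists>s. b f * c f \<prec>[s] f)"
    using up_timesE[OF F(2)] .
  let ?V = "{B \<in> cosets N Z. b ` F \<subseteq> B}" and ?W = "{B \<in> cosets N Z. c ` F \<subseteq> B}"
  show "\<exists>V W. openin (gtop CG) V \<and> openin (gtop CG) W \<and> B \<in> V \<and> C \<in> W \<and>
      (\<forall>B' C'. (B', C') \<in> composable CG \<longrightarrow> B' \<in> V \<longrightarrow> C' \<in> W \<longrightarrow> gmult CG B' C' \<in> U)"
  proof (intro exI conjI allI impI)
    show "openin (gtop CG) ?V" "openin (gtop CG) ?W"
      using F(1) by (auto intro!: openin_CG_nbhd)
    show "B \<in> ?V" "C \<in> ?W"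
      using BC bc by auto
    fix B' C' assume BC': "(B', C') \<in> composable CG" "B' \<in> ?V" "C' \<in> ?W"
    have "F \<subseteq> (B' * C')\<^sup>\<up>"
    proof
      fix f assume f: "f \<in> F"
      then obtain s where "b f * c f \<prec>[s] f" using bc by blast
      with f BC'(2,3) show "f \<in> (B' * C')\<^sup>\<up>"
        using in_upI[OF set_times_intro, of "b f" B' "c f" C'] by blast
    qed
    then show "gmult CG B' C' \<in> U"
      using F(3) BC'(1) prod_in_cosets by simp
  qed
qed

text \<open>Near \<open>C\<close>, membership of each \<open>f\<close> of a finite set in a coset \<open>(a D)\<^sup>\<up>\<close> is forced by \<open>s x \<in> D\<close> for some
  \<open>x \<prec>[t] f\<close>, as \<open>a s \<in> N\<close> gives \<open>a (s x) \<prec>[t] f\<close>.  So finitely many conditions on \<open>D\<close> suffice for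
  \<open>D\<close> to be the source of a coset in the given open set.\<close>

lemma open_src: "open_map (gtop CG) (gtop CG) (gsource CG)"
  unfolding open_map_def
proof (intro allI impI)
  fix U assume U: "openin (gtop CG) U"
  have "\<exists>G. finite G \<and> G \<subseteq> src C \<and> (\<forall>D\<in>cosets N Z. G \<subseteq> D \<longrightarrow> D \<in> src ` U)" if C: "C \<in> U" for C
  proof -
    obtain F where F: "finite F" "F \<subseteq> C" "\<forall>D\<in>cosets N Z. F \<subseteq> D \<longrightarrow> D \<in> U"
      and CC: "C \<in> cosets N Z"
      using openin_CG_D[OF U C] openin_subset[OF U] C by auto
    have SC: "s * c \<in> src C" if "s \<in> C\<^sup>\<star>" "c \<in> C" for s c
      unfolding src_eq using subsetD[OF dense_star_times[OF cosetsD(1)[OF CC]]] that by blast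
    obtain b where "b \<in> C" using cosetsD(6)[OF CC] by blast
    then obtain a s where a: "a \<in> C" "s \<in> C\<^sup>\<star>" "a \<prec>[s] b"
      using coset_below[OF CC] by metis
    then obtain a' v where a': "a' \<in> C" "v \<in> C\<^sup>\<star>" "a' \<prec>[v] a"
      using coset_below[OF CC] by metis
    have "\<exists>x\<in>C. \<exists>t. x \<prec>[t] f" if "f \<in> F" for f
      using coset_below[OF CC] F(2) that by (metis subsetD)
    from finite_choice[of F C, OF F(1) this] obtain G
      where G: "finite G" "G \<subseteq> C" "\<forall>f\<in>F. \<exists>x\<in>G. \<exists>t. x \<prec>[t] f" .
    \<comment> \<open>The first element makes \<open>D\<close> a unit, the others put \<open>F\<close> into the translate of \<open>D\<close> by \<open>a\<close>.\<close>
    let ?G = "insert (v * a') ((\<lambda>x. s * x) ` G)"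
    have "D \<in> src ` U" if D: "D \<in> cosets N Z" "?G \<subseteq> D" for D
    proof -
      let ?E = "{a} * D"
      have va: "v * a' \<in> D" using D(2) by blast
      note E = translate_unit[OF D(1) a'(3) va]
      have "F \<subseteq> ?E\<^sup>\<up>"
      proof
        fix f assume "f \<in> F"
        with G obtain x t where x: "x \<in> G" "x \<prec>[t] f" by blast
        have "a * (s * x) \<prec>[t] f"
          using via_N_left[OF viaD(3)[OF a(3)] x(2)] by (simp add: mult.assoc)
        moreover have "a * (s * x) \<in> ?E"
          using D(2) x(1) by (intro set_times_intro) auto
        ultimately show "f \<in> ?E\<^sup>\<up>" by (rule in_upI[rotated])
      qed
      moreover have "?E \<noteq> {}" using va by (auto simp: set_times_def)
      ultimately have "?E\<^sup>\<up> \<in> U"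
        using F(3) up_in_cosets[OF E(1)] by blast
      moreover have "src (?E\<^sup>\<up>) = D"
        using src_up[OF E(1)] E(2) by simp
      ultimately show ?thesis by blast
    qed
    moreover have "finite ?G" "?G \<subseteq> src C"
      using G SC a a' by auto
    ultimately show ?thesis by blast
  qed
  moreover have "src ` U \<subseteq> cosets N Z"
    using openin_subset[OF U] src_in_cosets by auto
  moreover have "gsource CG ` U = src ` U"
    by simp
  ultimately show "openin (gtop CG) (gsource CG ` U)"
    unfolding openin_CG_iff by auto
qed

lemma etale_CG: "etale_groupoid CG"
  using groupoid_CG continuous_star continuous_prod open_src
  by (simp add: etale_groupoid_def topological_groupoid_def)


section \<open>Germs\<close>

lemma star_coset_mult:
  assumes "C \<in> cosets N Z"
  shows "c \<in> C \<Longrightarrow> s \<in> C\<^sup>\<star> \<Longrightarrow> c * s \<in> rng C" "c \<in> C \<Longrightarrow> s \<in> C\<^sup>\<star> \<Longrightarrow> s * c \<in> src C"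
    and "s \<in> C\<^sup>\<star> \<Longrightarrow> p \<in> rng C \<Longrightarrow> s * p \<in> C\<^sup>\<star>" "s \<in> C\<^sup>\<star> \<Longrightarrow> q \<in> src C \<Longrightarrow> q * s \<in> C\<^sup>\<star>"
proof -
  note A = cosetsD(1)[OF assms]
  show "c \<in> C \<Longrightarrow> s \<in> C\<^sup>\<star> \<Longrightarrow> c * s \<in> rng C"
    using subsetD[OF dense_times_star[OF A] set_times_intro] unfolding rng_eq .
  show "c \<in> C \<Longrightarrow> s \<in> C\<^sup>\<star> \<Longrightarrow> s * c \<in> src C"
    using subsetD[OF dense_star_times[OF A] set_times_intro] unfolding src_eq .
  show "s \<in> C\<^sup>\<star> \<Longrightarrow> p \<in> rng C \<Longrightarrow> s * p \<in> C\<^sup>\<star>"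
    using subsetD[OF star_mult_rng_subset[OF A] set_times_intro] .
  show "s \<in> C\<^sup>\<star> \<Longrightarrow> q \<in> src C \<Longrightarrow> q * s \<in> C\<^sup>\<star>"
    using subsetD[OF src_mult_star_subset[OF A] set_times_intro] .
qed

text \<open>Multipliers may be taken from \<open>rng C\<close> and \<open>src C\<close> instead of \<open>C\<^sup>\<star>\<close>, since \<open>C\<^sup>\<star>\<close> absorbs both.\<close>

lemma germ_relI:
  assumes C: "C \<in> cosets N Z" and ab: "a \<in> C" "b \<in> C"
    and pq: "p \<in> rng C" "q \<in> src C" "p * (a * q) = p * (b * q)"
  shows "(a, b) \<in> germ_rel N Z C"
proof -
  obtain s where s: "s \<in> C\<^sup>\<star>"
    using cosetsD(6)[OF star_in_cosets[OF C]] by blast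
  have "(s * p) * a * (q * s) = (s * p) * b * (q * s)"
    using pq(3) by (metis mult.assoc)
  then show ?thesis
    using ab cosetsD(2)[OF C] star_coset_mult(3)[OF C s pq(1)] star_coset_mult(4)[OF C s pq(2)]
    unfolding germ_rel_def by auto
qed

text \<open>If \<open>c \<prec>[s] e\<close> with \<open>c \<in> C\<close>, then \<open>e \<in> C\<close> and \<open>e s \<in> Z\<close>, so a left multiplier \<open>s \<in> C\<^sup>\<star>\<close> is improved to the
  central \<open>e s\<close> by multiplying with \<open>e\<close>; similarly on the right.\<close>

lemma germ_relE:
  assumes C: "C \<in> cosets N Z" and ab: "(a, b) \<in> germ_rel N Z C"
  obtains z w where "z \<in> Z" "z \<in> rng C" "w \<in> Z" "w \<in> src C" "z * (a * w) = z * (b * w)"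
    and "a \<in> C" "b \<in> C"
proof -
  obtain s t where st: "s \<in> C\<^sup>\<star>" "t \<in> C\<^sup>\<star>" "s * a * t = s * b * t" and "a \<in> C" "b \<in> C"
    using ab cosetsD(2)[OF C] by (auto simp: germ_rel_def)
  obtain c e c' e' where c: "c \<in> C" "c \<prec>[s] e" "c' \<in> C" "c' \<prec>[t] e'"
    using st(1,2) by (auto simp: star_iff)
  then have e: "e \<in> C" "e' \<in> C"
    using in_upI[of _ C] cosetsD(2)[OF C] by auto
  have "(e * s) * (a * (t * e')) = (e * s) * (b * (t * e'))"
    using st(3) by (metis mult.assoc)
  then show thesis
    using that[of "e * s" "t * e'"] star_coset_mult(1,2)[OF C] e st viaD(5)[OF c(2)] viaD(6)[OF c(4)]
      \<open>a \<in> C\<close> \<open>b \<in> C\<close> by blast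
qed

lemma germ_rel_sym: "(a, b) \<in> germ_rel N Z C \<Longrightarrow> (b, a) \<in> germ_rel N Z C"
  by (auto simp: germ_rel_def) metis

lemma equiv_germ_rel:
  assumes C: "C \<in> cosets N Z"
  shows "equiv C (germ_rel N Z C)"
proof (rule equivI)
  show "germ_rel N Z C \<subseteq> C \<times> C"
    using cosetsD(2)[OF C] by (auto simp: germ_rel_def)
  obtain p q where pq: "p \<in> rng C" "q \<in> src C"
    using cosetsD(6)[OF rng_in_cosets[OF C]] cosetsD(6)[OF src_in_cosets[OF C]] by blast
  show "refl_on C (germ_rel N Z C)"
    using germ_relI[OF C _ _ pq] by (simp add: refl_on_def)
  show "sym (germ_rel N Z C)"
    by (rule symI) (rule germ_rel_sym)
  show "trans (germ_rel N Z C)"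
  proof (rule transI)
    fix a b c assume ab: "(a, b) \<in> germ_rel N Z C" and bc: "(b, c) \<in> germ_rel N Z C"
    obtain z w where 1: "z \<in> Z" "z \<in> rng C" "w \<in> Z" "w \<in> src C" "z * (a * w) = z * (b * w)"
      and a: "a \<in> C" using germ_relE[OF C ab] .
    obtain y x where 2: "y \<in> Z" "y \<in> rng C" "x \<in> Z" "x \<in> src C" "y * (b * x) = y * (c * x)"
      and c: "c \<in> C" using germ_relE[OF C bc] .
    have zy: "y * z = z * y" "w * x = x * w"
      using Z_comm Z_N 1 2 by metis+
    have "(y * z) * (a * (w * x)) = y * (z * (a * w)) * x"
      by (simp add: mult.assoc)
    also have "\<dots> = z * (y * (b * x)) * w"
      unfolding 1(5) using zy by (metis mult.assoc)
    also have "\<dots> = (y * z) * (c * (w * x))"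
      unfolding 2(5) using zy by (metis mult.assoc)
    finally have *: "(y * z) * (a * (w * x)) = (y * z) * (c * (w * x))" .
    have "y * z \<in> rng C"
      using 1 2 subsetD[OF mult_src_subset[OF cosetsD(1)[OF rng_in_cosets[OF C]]] set_times_intro]
        rng_idem[OF C] cosetsD(2)[OF rng_in_cosets[OF C]] by auto
    moreover have "w * x \<in> src C"
      using 1 2 subsetD[OF mult_src_subset[OF cosetsD(1)[OF src_in_cosets[OF C]]] set_times_intro]
        src_idem[OF C] cosetsD(2)[OF src_in_cosets[OF C]] by auto
    ultimately show "(a, c) \<in> germ_rel N Z C"
      using germ_relI[OF C a c] * by blast
  qed
qed

lemma germ_rel_trans:
  "C \<in> cosets N Z \<Longrightarrow> (a, b) \<in> germ_rel N Z C \<Longrightarrow> (b, c) \<in> germ_rel N Z C \<Longrightarrow>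
    (a, c) \<in> germ_rel N Z C"
  using equiv_germ_rel unfolding equiv_def by (blast dest: transD)

lemma germ_coset: "C \<in> cosets N Z \<Longrightarrow> germ N Z c C = (germ_rel N Z C `` {c}, C)"
  by (simp add: germ_def cosetsD)

lemma snd_germ [simp]: "C \<in> cosets N Z \<Longrightarrow> snd (germ N Z c C) = C"
  by (simp add: germ_coset)

lemma germ_eq_iff:
  assumes "C \<in> cosets N Z" "c \<in> C" "D \<in> cosets N Z" "d \<in> D"
  shows "germ N Z c C = germ N Z d D \<longleftrightarrow> C = D \<and> (c, d) \<in> germ_rel N Z C"
  using assms eq_equiv_class_iff[OF equiv_germ_rel, of C c d] by (auto simp: germ_coset)

lemma germ_eqI: "C \<in> cosets N Z \<Longrightarrow> (c, d) \<in> germ_rel N Z C \<Longrightarrow> germ N Z c C = germ N Z d C"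
  using equiv_class_eq[OF equiv_germ_rel] by (simp add: germ_coset)

lemma germ_up: "atlas N Z A \<Longrightarrow> germ N Z a A = germ N Z a (A\<^sup>\<up>)"
  by (simp add: germ_def germ_rel_def up_idem atlas_dense star_up)

lemma in_prod:
  assumes "B \<in> cosets N Z" "C \<in> cosets N Z" "b \<in> B" "c \<in> C"
  shows "b * c \<in> (B * C)\<^sup>\<up>"
  using subsetD[OF dense_times[OF cosetsD(3)[OF assms(1)] cosetsD(3)[OF assms(2)]]] assms(3,4)
  by blast

text \<open>The right multiplier \<open>w\<close> of the germ equation sits between \<open>a\<close> and \<open>b\<close>.  With \<open>u\<close> inverting \<open>b\<close>, the
  multiplier \<open>u w b\<close> on the far right has the same effect, because \<open>b u \<in> Z\<close> commutes with \<open>w\<close>.\<close>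

lemma germ_rel_mult_right:
  assumes BC: "B \<in> cosets N Z" "C \<in> cosets N Z" "src B = rng C"
    and a: "(a, a') \<in> germ_rel N Z B" and b: "b \<in> C"
  shows "(a * b, a' * b) \<in> germ_rel N Z ((B * C)\<^sup>\<up>)"
proof -
  obtain z w where z: "z \<in> Z" "z \<in> rng B" "w \<in> Z" "w \<in> src B" "z * (a * w) = z * (a' * w)"
    and aB: "a \<in> B" "a' \<in> B"
    using germ_relE[OF BC(1) a] .
  obtain b0 u where u: "b0 \<in> C" "u \<in> C\<^sup>\<star>" "b0 \<prec>[u] b"
    using coset_below[OF BC(2) b] .
  have "b * u * w = w * (b * u)"
    using Z_comm[OF z(3) Z_N[OF viaD(5)[OF u(3)]]] .
  then have w: "b * (u * (w * b)) = w * (b * (u * b))"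
    by (metis mult.assoc)
  show ?thesis
  proof (rule germ_relI[OF prod_in_cosets[OF BC]])
    show "a * b \<in> (B * C)\<^sup>\<up>" "a' * b \<in> (B * C)\<^sup>\<up>"
      using in_prod[OF BC(1,2)] aB b by blast+
    show "z \<in> rng ((B * C)\<^sup>\<up>)"
      using z by (simp add: src_prod_coset BC)
    show "(u * w) * b \<in> src ((B * C)\<^sup>\<up>)"
      using star_coset_mult(2)[OF BC(2) b star_coset_mult(3)[OF BC(2) u(2)]] z(4) BC(3)
      by (simp add: src_prod_coset BC)
    have "z * (a * b * (u * w * b)) = z * (a * w) * (b * (u * b))"
      by (simp add: mult.assoc w)
    also have "\<dots> = z * (a' * b * (u * w * b))"
      by (simp add: mult.assoc w z(5)[symmetric])
        (metis mult.assoc z(5))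
    finally show "z * (a * b * (u * w * b)) = z * (a' * b * (u * w * b))" .
  qed
qed

text \<open>Dually, \<open>z\<close> is moved across \<open>a\<close> by means of the left multiplier \<open>a z v\<close>.\<close>

lemma germ_rel_mult_left:
  assumes BC: "B \<in> cosets N Z" "C \<in> cosets N Z" "src B = rng C"
    and a: "a \<in> B" and b: "(b, b') \<in> germ_rel N Z C"
  shows "(a * b, a * b') \<in> germ_rel N Z ((B * C)\<^sup>\<up>)"
proof -
  obtain z w where z: "z \<in> Z" "z \<in> rng C" "w \<in> Z" "w \<in> src C" "z * (b * w) = z * (b' * w)"
    and bC: "b \<in> C" "b' \<in> C"
    using germ_relE[OF BC(2) b] .
  obtain a0 v where v: "a0 \<in> B" "v \<in> B\<^sup>\<star>" "a0 \<prec>[v] a"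
    using coset_below[OF BC(1) a] .
  have "z * (v * a) = v * a * z"
    using Z_comm[OF z(1) Z_N[OF viaD(6)[OF v(3)]]] by simp
  then have w: "a * (z * (v * (a * x))) = a * (v * (a * (z * x)))" for x
    by (metis mult.assoc)
  show ?thesis
  proof (rule germ_relI[OF prod_in_cosets[OF BC]])
    show "a * b \<in> (B * C)\<^sup>\<up>" "a * b' \<in> (B * C)\<^sup>\<up>"
      using in_prod[OF BC(1,2)] bC a by blast+
    show "w \<in> src ((B * C)\<^sup>\<up>)"
      using z by (simp add: src_prod_coset BC)
    show "a * (z * v) \<in> rng ((B * C)\<^sup>\<up>)"
      using star_coset_mult(1)[OF BC(1) a star_coset_mult(4)[OF BC(1) v(2)]] z(2) BC(3)
      by (simp add: src_prod_coset BC)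
    show "a * (z * v) * (a * b * w) = a * (z * v) * (a * b' * w)"
      by (simp add: mult.assoc w z(5))
  qed
qed

lemma germ_rel_mult:
  assumes "B \<in> cosets N Z" "C \<in> cosets N Z" "src B = rng C"
    and "(a, a') \<in> germ_rel N Z B" "(b, b') \<in> germ_rel N Z C"
  shows "(a * b, a' * b') \<in> germ_rel N Z ((B * C)\<^sup>\<up>)"
proof -
  have "b \<in> C" "a' \<in> B"
    using assms equiv_type[OF equiv_germ_rel] by blast+
  then show ?thesis
    using germ_rel_trans[OF prod_in_cosets[OF assms(1-3)]] germ_rel_mult_right[OF assms(1-4)] germ_rel_mult_left[OF assms(1-3) _ assms(5)] by blast
qed

lemma germ_atlas:
  assumes "atlas N Z A" "a \<in> A\<^sup>\<up>"
  shows "A\<^sup>\<up> \<in> cosets N Z" "germ N Z a A = germ N Z a (A\<^sup>\<up>)"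
  using assms coset_up[of A] germ_up by (auto simp: cosets_def)

text \<open>Representatives may come from arbitrary atlases; \<open>germ_atlas\<close> replaces these by the cosets they
  generate, and \<open>germ_rel_mult\<close> yields uniqueness.\<close>

lemma germ_mult_germ:
  assumes BC: "B \<in> cosets N Z" "C \<in> cosets N Z" "src B = rng C" and bc: "b \<in> B" "c \<in> C"
  shows "germ_mult N Z (germ N Z b B) (germ N Z c C) = germ N Z (b * c) ((B * C)\<^sup>\<up>)"
  unfolding germ_mult_def
proof (rule the_equality)
  have "atlas N Z (B * C)"
    using atlas_prod cosetsD(1) BC by blast
  then have "germ N Z (b * c) ((B * C)\<^sup>\<up>) = germ N Z (b * c) (B * C)"
    by (simp add: germ_up)
  then show "\<exists>a A d D. atlas N Z A \<and> a \<in> A\<^sup>\<up> \<and> atlas N Z D \<and> d \<in> D\<^sup>\<up> \<and> src A = rng D \<and>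
      germ N Z b B = germ N Z a A \<and> germ N Z c C = germ N Z d D \<and>
      germ N Z (b * c) ((B * C)\<^sup>\<up>) = germ N Z (a * d) (A * D)"
    using BC bc cosetsD(1,2) by (intro exI[of _ b] exI[of _ B] exI[of _ c] exI[of _ C]) simp
next
  fix z assume "\<exists>a A d D. atlas N Z A \<and> a \<in> A\<^sup>\<up> \<and> atlas N Z D \<and> d \<in> D\<^sup>\<up> \<and> src A = rng D \<and>
      germ N Z b B = germ N Z a A \<and> germ N Z c C = germ N Z d D \<and> z = germ N Z (a * d) (A * D)"
  then obtain a A d D where A: "atlas N Z A" "a \<in> A\<^sup>\<up>" and D: "atlas N Z D" "d \<in> D\<^sup>\<up>"
    and AD: "src A = rng D" and eq: "germ N Z b B = germ N Z a A" "germ N Z c C = germ N Z d D"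
    and z: "z = germ N Z (a * d) (A * D)" by blast
  have "B = A\<^sup>\<up>" "(b, a) \<in> germ_rel N Z B"
    using eq(1) unfolding germ_atlas(2)[OF A] germ_eq_iff[OF BC(1) bc(1) germ_atlas(1)[OF A] A(2)]
    by blast+
  moreover have "C = D\<^sup>\<up>" "(c, d) \<in> germ_rel N Z C"
    using eq(2) unfolding germ_atlas(2)[OF D] germ_eq_iff[OF BC(2) bc(2) germ_atlas(1)[OF D] D(2)]
    by blast+
  moreover have "(A * D)\<^sup>\<up> = (A\<^sup>\<up> * D\<^sup>\<up>)\<^sup>\<up>"
    by (simp add: up_times_up atlas_dense A D)
  ultimately show "z = germ N Z (b * c) ((B * C)\<^sup>\<up>)"
    using germ_eqI[OF prod_in_cosets[OF BC] germ_rel_mult[OF BC]] germ_up[OF atlas_prod[OF A(1) D(1) AD]]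
    by (simp add: z)
qed

text \<open>The germ of \<open>c c'\<close> is a unit, since \<open>c c'\<close> fixes \<open>d c' \<in> rng C\<close>, which serves as multiplier.\<close>

lemma mult_inverse_right:
  assumes B: "B \<in> cosets N Z" and C: "C \<in> cosets N Z" and BC: "src B = rng C" and x: "x \<in> B"
    and d: "d \<in> C" "d \<prec>[c'] c"
  shows "(x * (c * c'), x) \<in> germ_rel N Z B"
proof -
  obtain p where p: "p \<in> rng B"
    using cosetsD(6)[OF rng_in_cosets[OF B]] by blast
  have q: "d * c' \<in> src B"
    using star_coset_mult(1)[OF C d(1) in_starI[OF d]] BC by simp
  have "c \<in> C" using in_upI[OF d] cosetsD(2)[OF C] by simp
  then have "c * c' \<in> src B"
    using star_coset_mult(1)[OF C _ in_starI[OF d]] BC by simp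
  then have "x * (c * c') \<in> B"
    using subsetD[OF mult_src_subset[OF cosetsD(1)[OF B]] set_times_intro] x cosetsD(2)[OF B] by simp
  from germ_relI[OF B this x p q] show ?thesis
    by (simp add: mult.assoc viaD[OF d(2)])
qed

lemma mult_inverse_left:
  assumes B: "B \<in> cosets N Z" and C: "C \<in> cosets N Z" and BC: "rng B = src C" and x: "x \<in> B"
    and d: "d \<in> C" "d \<prec>[c'] c"
  shows "(c' * c * x, x) \<in> germ_rel N Z B"
proof -
  obtain q where q: "q \<in> src B"
    using cosetsD(6)[OF src_in_cosets[OF B]] by blast
  have p: "c' * d \<in> rng B"
    using star_coset_mult(2)[OF C d(1) in_starI[OF d]] BC by simp
  have "c \<in> C" using in_upI[OF d] cosetsD(2)[OF C] by simp
  then have "c' * c \<in> rng B"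
    using star_coset_mult(2)[OF C _ in_starI[OF d]] BC by simp
  then have "c' * c * x \<in> B"
    using subsetD[OF rng_mult_subset[OF cosetsD(1)[OF B]] set_times_intro] x cosetsD(2)[OF B] by simp
  from germ_relI[OF B this x p q] show ?thesis
    by (simp add: mult.assoc viaD[OF d(2)])
qed

text \<open>Uniqueness of inverses: \<open>c' \<sim> c' e e' \<sim> c' c e' \<sim> e'\<close>.\<close>

lemma germ_rel_inverse:
  assumes C: "C \<in> cosets N Z" and ce: "(c, e) \<in> germ_rel N Z C"
    and d: "d \<in> C" "d \<prec>[c'] c" and f: "f \<in> C" "f \<prec>[e'] e"
  shows "(c', e') \<in> germ_rel N Z (C\<^sup>\<star>)"
proof -
  note S = star_in_cosets[OF C] and R = src_in_cosets[OF C]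
  note A = cosetsD(1)[OF C]
  have s: "c' \<in> C\<^sup>\<star>" "e' \<in> C\<^sup>\<star>"
    using in_starI d f by blast+
  have "(c' * (e * e'), c') \<in> germ_rel N Z (C\<^sup>\<star>)"
    using mult_inverse_right[OF S C src_star[OF A] s(1) f] .
  moreover have "(c' * c * e', e') \<in> germ_rel N Z (C\<^sup>\<star>)"
    using mult_inverse_left[OF S C rng_star[OF A] s(2) d] .
  moreover have "(c' * c * e', c' * (e * e')) \<in> germ_rel N Z (C\<^sup>\<star>)"
  proof -
    have "(c' * c, c' * e) \<in> germ_rel N Z (src C)"
      using germ_rel_mult_left[OF S C src_star[OF A] s(1) ce] by (simp add: src_eq)
    from germ_rel_mult_right[OF R S _ this s(2)] show ?thesis
      using src_idem[OF C] rng_star[OF A] up_rng_mult[OF atlas_star[OF A]] cosetsD(4)[OF C]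
      by (simp add: mult.assoc)
  qed
  ultimately show ?thesis
    using germ_rel_trans[OF S] germ_rel_sym by blast
qed

lemma germ_inv_germ:
  assumes C: "C \<in> cosets N Z" and d: "d \<in> C" "d \<prec>[c'] c"
  shows "germ_inv N Z (germ N Z c C) = germ N Z c' (C\<^sup>\<star>)"
  unfolding germ_inv_def
proof (rule the_equality)
  have c: "c \<in> C" using in_upI[OF d] cosetsD(2)[OF C] by simp
  then show "\<exists>e E f e'. E \<in> cosets N Z \<and> e \<in> E \<and> f \<in> E \<and> f \<prec>[e'] e \<and>
      germ N Z c C = germ N Z e E \<and> germ N Z c' (C\<^sup>\<star>) = germ N Z e' (E\<^sup>\<star>)"
    using C d by (intro exI[of _ c] exI[of _ C] exI[of _ d] exI[of _ c']) simp
  fix y assume "\<exists>e E f e'. E \<in> cosets N Z \<and> e \<in> E \<and> f \<in> E \<and> f \<prec>[e'] e \<and>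
      germ N Z c C = germ N Z e E \<and> y = germ N Z e' (E\<^sup>\<star>)"
  then obtain e E f e' where E: "E \<in> cosets N Z" "e \<in> E" "f \<in> E" "f \<prec>[e'] e"
    "germ N Z c C = germ N Z e E" and y: "y = germ N Z e' (E\<^sup>\<star>)" by blast
  have "C = E" and "(c, e) \<in> germ_rel N Z C"
    using E(5) germ_eq_iff[OF C c E(1,2)] by blast+
  from germ_eqI[OF star_in_cosets[OF C] germ_rel_inverse[OF C this(2) d]] E(3,4) this(1)
  show "y = germ N Z c' (C\<^sup>\<star>)"
    by (simp add: y)
qed


section \<open>The groupoid of germs\<close>

abbreviation GG :: "('a set \<times> 'a set) top_groupoid" where "GG \<equiv> germ_groupoid N Z"

lemma GG_simps [simp]:
  "arrows GG = germs N Z" "gmult GG = germ_mult N Z" "ginv GG = germ_inv N Z"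
  by (simp_all add: germ_groupoid_def)

lemma germsE:
  assumes "x \<in> germs N Z"
  obtains c C where "C \<in> cosets N Z" "c \<in> C" "x = germ N Z c C"
  using assms by (auto simp: germs_def)

lemma germ_in_germs: "C \<in> cosets N Z \<Longrightarrow> c \<in> C \<Longrightarrow> germ N Z c C \<in> germs N Z"
  by (auto simp: germs_def)

lemma composable_GG [simp]:
  "(x, y) \<in> composable GG \<longleftrightarrow> x \<in> germs N Z \<and> y \<in> germs N Z \<and> src (snd x) = rng (snd y)"
proof
  assume "(x, y) \<in> composable GG"
  then obtain a A b B where A: "atlas N Z A" "a \<in> A\<^sup>\<up>" and B: "atlas N Z B" "b \<in> B\<^sup>\<up>"
    and AB: "src A = rng B" and eq: "x = germ N Z a A" "y = germ N Z b B"
    by (auto simp: germ_groupoid_def germ_composable_def)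
  have "x = germ N Z a (A\<^sup>\<up>)" "y = germ N Z b (B\<^sup>\<up>)"
    using eq germ_atlas[OF A] germ_atlas[OF B] by simp_all
  then show "x \<in> germs N Z \<and> y \<in> germs N Z \<and> src (snd x) = rng (snd y)"
    using germ_atlas(1)[OF A] germ_atlas(1)[OF B] germ_in_germs A B AB
    by (simp add: src_up rng_up)
next
  assume R: "x \<in> germs N Z \<and> y \<in> germs N Z \<and> src (snd x) = rng (snd y)"
  then obtain a A b B where A: "A \<in> cosets N Z" "a \<in> A" "x = germ N Z a A"
    and B: "B \<in> cosets N Z" "b \<in> B" "y = germ N Z b B"
    by (metis germsE)
  have "src A = rng B" using R A B by simp
  then have "(germ N Z a A, germ N Z b B) \<in> germ_composable N Z"
    using A(1,2) B(1,2) cosetsD(1,2) unfolding germ_composable_def by blast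
  then show "(x, y) \<in> composable GG"
    using A(3) B(3) by (simp add: germ_groupoid_def)
qed

lemma composable_germE:
  assumes "(x, y) \<in> composable GG"
  obtains b B c C where "B \<in> cosets N Z" "C \<in> cosets N Z" "src B = rng C" "b \<in> B" "c \<in> C"
    "x = germ N Z b B" "y = germ N Z c C"
    "germ_mult N Z x y = germ N Z (b * c) ((B * C)\<^sup>\<up>)"
proof -
  have *: "x \<in> germs N Z" "y \<in> germs N Z" "src (snd x) = rng (snd y)"
    using assms by simp_all
  obtain b B where B: "B \<in> cosets N Z" "b \<in> B" "x = germ N Z b B"
    using germsE[OF *(1)] .
  obtain c C where C: "C \<in> cosets N Z" "c \<in> C" "y = germ N Z c C"
    using germsE[OF *(2)] .
  have "src B = rng C" using * B C by simp
  with that[OF B(1) C(1) _ B(2) C(2) B(3) C(3)] germ_mult_germ[OF B(1) C(1) _ B(2) C(2)] B(3) C(3)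
  show thesis by simp
qed

lemma germ_invE:
  assumes "x \<in> germs N Z"
  obtains c C d c' where "C \<in> cosets N Z" "c \<in> C" "x = germ N Z c C" "d \<in> C" "d \<prec>[c'] c"
    "c' \<in> C\<^sup>\<star>" "germ_inv N Z x = germ N Z c' (C\<^sup>\<star>)"
proof -
  obtain c C where C: "C \<in> cosets N Z" "c \<in> C" "x = germ N Z c C"
    using germsE[OF assms] .
  obtain d c' where d: "d \<in> C" "c' \<in> C\<^sup>\<star>" "d \<prec>[c'] c"
    using coset_below[OF C(1,2)] .
  show thesis
    using that[OF C d(1,3,2)] germ_inv_germ[OF C(1) d(1,3)] C(3) by simp
qed

lemma mult_in_germs: "(x, y) \<in> composable GG \<Longrightarrow> germ_mult N Z x y \<in> germs N Z"
  by (erule composable_germE) (simp add: germ_in_germs prod_in_cosets in_prod)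

lemma snd_mult: "(x, y) \<in> composable GG \<Longrightarrow> snd (germ_mult N Z x y) = (snd x * snd y)\<^sup>\<up>"
  by (erule composable_germE) (simp add: prod_in_cosets)

lemma snd_inv: "x \<in> germs N Z \<Longrightarrow> snd (germ_inv N Z x) = (snd x)\<^sup>\<star>"
  by (erule germ_invE) (simp add: star_in_cosets)

lemma inv_in_germs: "x \<in> germs N Z \<Longrightarrow> germ_inv N Z x \<in> germs N Z"
  by (erule germ_invE) (simp add: germ_in_germs star_in_cosets)

lemma snd_in_cosets: "x \<in> germs N Z \<Longrightarrow> snd x \<in> cosets N Z"
  by (erule germsE) simp

lemma germ_mult_assoc:
  assumes "(x, y) \<in> composable GG" "(y, z) \<in> composable GG"
  shows "germ_mult N Z (germ_mult N Z x y) z = germ_mult N Z x (germ_mult N Z y z)"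
proof -
  obtain b B c C where B: "B \<in> cosets N Z" "b \<in> B" "x = germ N Z b B"
    and C: "C \<in> cosets N Z" "c \<in> C" "y = germ N Z c C" and BC: "src B = rng C"
    using composable_germE[OF assms(1)] by metis
  obtain d D where D: "D \<in> cosets N Z" "d \<in> D" "z = germ N Z d D"
    using assms(2) germsE by (metis composable_GG)
  have CD: "src C = rng D" using assms(2) C D by simp
  show ?thesis
    using B C D BC CD
    by (simp add: germ_mult_germ prod_in_cosets in_prod src_prod_coset prod_coset_assoc mult.assoc)
qed

text \<open>The inverse of \<open>c'\<close> may be taken to be \<open>c\<close>, since \<open>star_below\<close> provides an \<open>s \<in> C\<^sup>\<star>\<close> with \<open>s \<prec>[c] c'\<close>.\<close>

lemma germ_inv_inv:
  assumes "x \<in> germs N Z"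
  shows "germ_inv N Z (germ_inv N Z x) = x"
proof -
  obtain c C d c' where C: "C \<in> cosets N Z" "x = germ N Z c C" and d: "d \<in> C" "d \<prec>[c'] c"
    and inv: "germ_inv N Z x = germ N Z c' (C\<^sup>\<star>)"
    using germ_invE[OF assms] .
  obtain s where "s \<in> C\<^sup>\<star>" "s \<prec>[c] c'"
    using star_below[OF cosetsD(3)[OF C(1)] d] .
  from germ_inv_germ[OF star_in_cosets[OF C(1)] this] show ?thesis
    using inv C cosetsD(5)[OF C(1)] by simp
qed

lemma germ_mult_cancel:
  assumes "(x, y) \<in> composable GG"
  shows "germ_mult N Z (germ_inv N Z x) (germ_mult N Z x y) = y"
    and "germ_mult N Z (germ_mult N Z x y) (germ_inv N Z y) = x"
proof -
  have *: "x \<in> germs N Z" "y \<in> germs N Z" "src (snd x) = rng (snd y)"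
    using assms by simp_all
  obtain b B e b' where B: "B \<in> cosets N Z" "b \<in> B" "x = germ N Z b B" "e \<in> B" "e \<prec>[b'] b"
    "b' \<in> B\<^sup>\<star>" "germ_inv N Z x = germ N Z b' (B\<^sup>\<star>)"
    using germ_invE[OF *(1)] .
  obtain c C d c' where C: "C \<in> cosets N Z" "c \<in> C" "y = germ N Z c C" "d \<in> C" "d \<prec>[c'] c"
    "c' \<in> C\<^sup>\<star>" "germ_inv N Z y = germ N Z c' (C\<^sup>\<star>)"
    using germ_invE[OF *(2)] .
  have BC: "src B = rng C" using * B(1,3) C(1,3) by simp
  note P = prod_in_cosets[OF B(1) C(1) BC] in_prod[OF B(1) C(1) B(2) C(2)]
    src_prod_coset[OF B(1) C(1) BC] prod_coset_cancel[OF B(1) C(1) BC]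
  have xy: "germ_mult N Z x y = germ N Z (b * c) ((B * C)\<^sup>\<up>)"
    using germ_mult_germ[OF B(1) C(1) BC B(2) C(2)] B(3) C(3) by simp
  have "germ_mult N Z (germ_inv N Z x) (germ_mult N Z x y) = germ N Z (b' * (b * c)) C"
    using germ_mult_germ[OF star_in_cosets[OF B(1)] P(1) _ B(6) P(2)] P src_star[OF cosetsD(1)[OF B(1)]]
    by (simp add: xy B(7))
  also have "\<dots> = germ N Z c C"
    using germ_eqI[OF C(1) mult_inverse_left[OF C(1) B(1) _ C(2) B(4,5)]] BC by (simp add: mult.assoc)
  finally show "germ_mult N Z (germ_inv N Z x) (germ_mult N Z x y) = y"
    by (simp add: C(3))
  have "germ_mult N Z (germ_mult N Z x y) (germ_inv N Z y) = germ N Z (b * (c * c')) B"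
    using germ_mult_germ[OF P(1) star_in_cosets[OF C(1)] _ P(2) C(6)] P rng_star[OF cosetsD(1)[OF C(1)]]
    by (simp add: xy C(7) mult.assoc)
  also have "\<dots> = germ N Z b B"
    using germ_eqI[OF B(1) mult_inverse_right[OF B(1) C(1) BC B(2) C(4,5)]] .
  finally show "germ_mult N Z (germ_mult N Z x y) (germ_inv N Z y) = x"
    by (simp add: B(3))
qed

lemma groupoid_GG: "groupoid GG"
  unfolding groupoid_def
proof (intro conjI allI ballI impI)
  show "composable GG \<subseteq> arrows GG \<times> arrows GG"
    by auto
next
  fix x y assume xy: "(x, y) \<in> composable GG"
  then show "gmult GG x y \<in> arrows GG"
    using mult_in_germs by (simp del: composable_GG)
  show "gmult GG (ginv GG x) (gmult GG x y) = y" "gmult GG (gmult GG x y) (ginv GG y) = x"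
    using germ_mult_cancel[OF xy] by simp_all
next
  fix x y z assume xyz: "(x, y) \<in> composable GG \<and> (y, z) \<in> composable GG"
  then show "gmult GG (gmult GG x y) z = gmult GG x (gmult GG y z)"
    using germ_mult_assoc by (simp del: composable_GG)
  show "(gmult GG x y, z) \<in> composable GG" "(x, gmult GG y z) \<in> composable GG"
    using xyz mult_in_germs[of x y] mult_in_germs[of y z] snd_mult[of x y] snd_mult[of y z]
    by (simp_all add: src_prod_coset snd_in_cosets)
next
  fix x assume x: "x \<in> arrows GG"
  then show "ginv GG x \<in> arrows GG" "ginv GG (ginv GG x) = x"
    by (simp_all add: inv_in_germs germ_inv_inv)
  show "(x, ginv GG x) \<in> composable GG" "(ginv GG x, x) \<in> composable GG"
    using x cosetsD(1)[OF snd_in_cosets, of x]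
    by (simp_all add: inv_in_germs snd_inv src_star rng_star)
qed

text \<open>The local section through \<open>c\<close>, restricted to the cosets that contain \<open>F\<close>.\<close>

definition germ_nbhd :: "'a \<Rightarrow> 'a set \<Rightarrow> ('a set \<times> 'a set) set" where
  "germ_nbhd c F = {germ N Z c C |C. C \<in> cosets N Z \<and> c \<in> C \<and> F \<subseteq> C}"

lemma openin_germ_nbhd: "finite F \<Longrightarrow> openin (gtop GG) (germ_nbhd c F)"
proof (induction rule: finite_induct)
  case empty
  show ?case
    unfolding germ_groupoid_def germ_nbhd_def
    by (simp, rule topology_generated_by_Basis) auto
next
  case (insert f F)
  let ?P = "{germ N Z c C | c C. C \<in> cosets N Z \<and> c \<in> C \<and> f \<in> C}"
  have "openin (gtop GG) ?P"
    unfolding germ_groupoid_def by (simp, rule topology_generated_by_Basis) auto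
  moreover have "germ_nbhd c (insert f F) = germ_nbhd c F \<inter> ?P"
  proof
    show "germ_nbhd c (insert f F) \<subseteq> germ_nbhd c F \<inter> ?P"
      by (auto simp: germ_nbhd_def)
    show "germ_nbhd c F \<inter> ?P \<subseteq> germ_nbhd c (insert f F)"
    proof
      fix x assume x: "x \<in> germ_nbhd c F \<inter> ?P"
      then obtain C where C: "x = germ N Z c C" "C \<in> cosets N Z" "c \<in> C" "F \<subseteq> C"
        by (auto simp: germ_nbhd_def)
      obtain d D where D: "x = germ N Z d D" "D \<in> cosets N Z" "f \<in> D"
        using x by auto
      have "snd x = C" using C(1,2) by simp
      moreover have "snd x = D" using D(1,2) by simp
      ultimately show "x \<in> germ_nbhd c (insert f F)"
        using C D(3) by (auto simp: germ_nbhd_def)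
    qed
  qed
  ultimately show ?case
    using insert.IH by (simp add: openin_Int)
qed

text \<open>For a subbasic set of germs \<open>[s, D]\<close>, the equality \<open>[c, C] = [s, C]\<close> is an equation \<open>p c q = p s q\<close>
  with \<open>p, q \<in> C\<^sup>\<star>\<close>.  The elements \<open>x, x' \<in> C\<close> inverted by \<open>p, q\<close> guarantee \<open>p, q \<in> E\<^sup>\<star>\<close> for every coset \<open>E\<close>
  containing them, so the equality holds at all such \<open>E\<close> that contain \<open>c\<close> and \<open>s\<close>.\<close>

lemma openin_GG_D:
  assumes U: "openin (gtop GG) U" "germ N Z c C \<in> U" and C: "C \<in> cosets N Z" "c \<in> C"
  obtains F where "finite F" "F \<subseteq> C" "germ_nbhd c F \<subseteq> U"
proof -
  let ?S = "{{germ N Z s C | C. C \<in> cosets N Z \<and> s \<in> C} | s. True} \<union>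
          {{germ N Z c C | c C. C \<in> cosets N Z \<and> c \<in> C \<and> s \<in> C} | s. True}"
  have gen: "openin (topology_generated_by ?S) U"
    using U(1) by (simp add: germ_groupoid_def)
  obtain \<F> where \<F>: "finite \<F>" "\<F> \<subseteq> ?S" "germ N Z c C \<in> \<Inter>\<F>" "\<Inter>\<F> \<subseteq> U"
    using bspec[OF iffD1[OF openin_generated_iff gen] U(2)] by (elim exE conjE)
  have "\<exists>F. finite F \<and> F \<subseteq> C \<and> germ_nbhd c F \<subseteq> V" if V: "V \<in> \<F>" for V
  proof -
    have cV: "germ N Z c C \<in> V" using \<F>(3) V by blast
    from subsetD[OF \<F>(2) V] consider s where "V = {germ N Z s C | C. C \<in> cosets N Z \<and> s \<in> C}"
      | s where "V = {germ N Z c C | c C. C \<in> cosets N Z \<and> c \<in> C \<and> s \<in> C}"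
      by (elim UnE CollectE exE conjE)
    then show ?thesis
    proof cases
      case 1
      with cV obtain D where D: "germ N Z c C = germ N Z s D" "D \<in> cosets N Z" "s \<in> D"
        by auto
      then have "(c, s) \<in> germ_rel N Z C" and sC: "s \<in> C"
        using germ_eq_iff[OF C D(2,3)] by auto
      then obtain p q where p: "p \<in> C\<^sup>\<star>" and q: "q \<in> C\<^sup>\<star>" and pq: "p * c * q = p * s * q"
        by (auto simp: germ_rel_def)
      obtain x y x' y' where x: "x \<in> C" "x \<prec>[p] y" "x' \<in> C" "x' \<prec>[q] y'"
        using p q by (auto simp: star_iff)
      have "germ_nbhd c {s, x, x'} \<subseteq> V"
      proof
        fix g assume "g \<in> germ_nbhd c {s, x, x'}"
        then obtain E where E: "g = germ N Z c E" "E \<in> cosets N Z" "c \<in> E" "s \<in> E" "x \<in> E" "x' \<in> E"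
          by (auto simp: germ_nbhd_def)
        have "p \<in> E\<^sup>\<star>" "q \<in> E\<^sup>\<star>"
          using in_starI x E(5,6) by blast+
        then have "(c, s) \<in> germ_rel N Z E"
          using pq E cosetsD(2)[OF E(2)] unfolding germ_rel_def by auto
        then show "g \<in> V"
          using germ_eqI[OF E(2)] E 1 by auto
      qed
      then show ?thesis
        using sC x by (intro exI[of _ "{s, x, x'}"]) simp
    next
      case 2
      with cV obtain d D where D: "germ N Z c C = germ N Z d D" "D \<in> cosets N Z" "s \<in> D"
        by auto
      then have "s \<in> C"
        using snd_germ[OF C(1), of c] by simp
      moreover have "germ_nbhd c {s} \<subseteq> V"
        using 2 by (auto simp: germ_nbhd_def)
      ultimately show ?thesis
        by (intro exI[of _ "{s}"]) simp
    qed
  qed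
  then obtain g where g: "\<forall>V\<in>\<F>. finite (g V) \<and> g V \<subseteq> C \<and> germ_nbhd c (g V) \<subseteq> V"
    by metis
  have "germ_nbhd c (\<Union>(g ` \<F>)) \<subseteq> \<Inter>\<F>"
  proof (rule Inter_greatest)
    fix V assume V: "V \<in> \<F>"
    have "germ_nbhd c (\<Union>(g ` \<F>)) \<subseteq> germ_nbhd c (g V)"
      using V by (auto simp: germ_nbhd_def)
    also have "\<dots> \<subseteq> V" using g V by blast
    finally show "germ_nbhd c (\<Union>(g ` \<F>)) \<subseteq> V" .
  qed
  then have "germ_nbhd c (\<Union>(g ` \<F>)) \<subseteq> U" using \<F>(4) by (rule order_trans)
  moreover have "finite (\<Union>(g ` \<F>))" "\<Union>(g ` \<F>) \<subseteq> C" using g \<F>(1) by auto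
  ultimately show thesis using that by blast
qed

lemma germ_in_nbhd: "C \<in> cosets N Z \<Longrightarrow> c \<in> C \<Longrightarrow> F \<subseteq> C \<Longrightarrow> germ N Z c C \<in> germ_nbhd c F"
  by (auto simp: germ_nbhd_def)

lemma topspace_GG [simp]: "topspace (gtop GG) = germs N Z"
proof
  have "\<Union>({{germ N Z s C | C. C \<in> cosets N Z \<and> s \<in> C} | s. True} \<union>
          {{germ N Z c C | c C. C \<in> cosets N Z \<and> c \<in> C \<and> s \<in> C} | s. True}) \<subseteq> germs N Z"
    by (auto simp: germs_def)
  then show "topspace (gtop GG) \<subseteq> germs N Z"
    by (simp add: germ_groupoid_def topology_generated_by_topspace)
  show "germs N Z \<subseteq> topspace (gtop GG)"
  proof
    fix x assume "x \<in> germs N Z"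
    then obtain c C where "C \<in> cosets N Z" "c \<in> C" "x = germ N Z c C" by (rule germsE)
    then have "x \<in> germ_nbhd c {}" using germ_in_nbhd by simp
    then show "x \<in> topspace (gtop GG)"
      using openin_subset[OF openin_germ_nbhd[of "{}" c]] by blast
  qed
qed

lemma openin_GG_I:
  assumes "U \<subseteq> germs N Z"
    and "\<And>c C. C \<in> cosets N Z \<Longrightarrow> c \<in> C \<Longrightarrow> germ N Z c C \<in> U \<Longrightarrow>
      \<exists>F. finite F \<and> F \<subseteq> C \<and> germ_nbhd c F \<subseteq> U"
  shows "openin (gtop GG) U"
proof (subst openin_subopen, rule ballI)
  fix x assume "x \<in> U"
  with assms(1) obtain c C where C: "C \<in> cosets N Z" "c \<in> C" "x = germ N Z c C"
    by (metis germsE subsetD)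
  with assms(2) \<open>x \<in> U\<close> obtain F where F: "finite F" "F \<subseteq> C" "germ_nbhd c F \<subseteq> U"
    by metis
  show "\<exists>T. openin (gtop GG) T \<and> x \<in> T \<and> T \<subseteq> U"
    using F(3) openin_germ_nbhd[OF F(1)] germ_in_nbhd[OF C(1,2) F(2)] C(3) by auto
qed

text \<open>The representative \<open>c'\<close> of the inverse works for all cosets containing \<open>c\<close> and the \<open>d\<close> with
  \<open>d \<prec>[c'] c\<close>, so in local sections inversion is \<open>C \<mapsto> C\<^sup>\<star>\<close>.\<close>

lemma continuous_germ_inv: "continuous_map (gtop GG) (gtop GG) (ginv GG)"
  unfolding continuous_map_def
proof (intro conjI allI impI)
  show "ginv GG \<in> topspace (gtop GG) \<rightarrow> topspace (gtop GG)"
    by (simp add: inv_in_germs)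
  fix U assume U: "openin (gtop GG) U"
  show "openin (gtop GG) {x \<in> topspace (gtop GG). ginv GG x \<in> U}"
  proof (rule openin_GG_I)
    fix c C assume C: "C \<in> cosets N Z" "c \<in> C"
      and "germ N Z c C \<in> {x \<in> topspace (gtop GG). ginv GG x \<in> U}"
    then have inv: "germ_inv N Z (germ N Z c C) \<in> U" by simp
    obtain d c' where d: "d \<in> C" "c' \<in> C\<^sup>\<star>" "d \<prec>[c'] c"
      using coset_below[OF C] .
    obtain F where F: "finite F" "F \<subseteq> C\<^sup>\<star>" "germ_nbhd c' F \<subseteq> U"
      using openin_GG_D[OF U _ star_in_cosets[OF C(1)] d(2)] inv germ_inv_germ[OF C(1) d(1,3)]
      by metis
    have "\<exists>x\<in>C. \<exists>b. x \<prec>[f] b" if "f \<in> F" for f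
      using F(2) that by (auto simp: star_iff)
    from finite_choice[of F C, OF F(1) this] obtain G
      where G: "finite G" "G \<subseteq> C" "\<forall>f\<in>F. \<exists>x\<in>G. \<exists>b. x \<prec>[f] b" .
    have "germ_nbhd c (insert d G) \<subseteq> {x \<in> topspace (gtop GG). ginv GG x \<in> U}"
    proof
      fix x assume "x \<in> germ_nbhd c (insert d G)"
      then obtain D where D: "x = germ N Z c D" "D \<in> cosets N Z" "c \<in> D" "d \<in> D" "G \<subseteq> D"
        by (auto simp: germ_nbhd_def)
      have "F \<subseteq> D\<^sup>\<star>"
      proof
        fix f assume "f \<in> F"
        with G(3) obtain y b where "y \<in> G" "y \<prec>[f] b" by blast
        then show "f \<in> D\<^sup>\<star>" using D(5) in_starI by blast
      qed
      then have "germ N Z c' (D\<^sup>\<star>) \<in> U"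
        using F(3) germ_in_nbhd[OF star_in_cosets[OF D(2)] in_starI[OF D(4) d(3)]] by blast
      then show "x \<in> {x \<in> topspace (gtop GG). ginv GG x \<in> U}"
        using germ_inv_germ[OF D(2,4) d(3)] germ_in_germs[OF D(2,3)] D(1) by simp
    qed
    then show "\<exists>F. finite F \<and> F \<subseteq> C \<and> germ_nbhd c F \<subseteq> {x \<in> topspace (gtop GG). ginv GG x \<in> U}"
      using G d by (intro exI[of _ "insert d G"]) simp
  qed auto
qed

lemma continuous_germ_mult:
  "continuous_map (subtopology (prod_topology (gtop GG) (gtop GG)) (composable GG)) (gtop GG)
     (\<lambda>(x, y). gmult GG x y)"
proof (rule continuous_map_prod_subI)
  show "composable GG \<subseteq> topspace (gtop GG) \<times> topspace (gtop GG)"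
    by auto
  fix x y assume xy: "(x, y) \<in> composable GG"
  then show "gmult GG x y \<in> topspace (gtop GG)"
    using mult_in_germs by (simp del: composable_GG)
  fix U assume U: "openin (gtop GG) U" "gmult GG x y \<in> U"
  obtain b B c C where B: "B \<in> cosets N Z" "b \<in> B" "x = germ N Z b B"
    and C: "C \<in> cosets N Z" "c \<in> C" "y = germ N Z c C" and BC: "src B = rng C"
    and m: "germ_mult N Z x y = germ N Z (b * c) ((B * C)\<^sup>\<up>)"
    using composable_germE[OF xy] by metis
  obtain F where F: "finite F" "F \<subseteq> (B * C)\<^sup>\<up>" "germ_nbhd (b * c) F \<subseteq> U"
    using openin_GG_D[OF U(1) _ prod_in_cosets[OF B(1) C(1) BC] in_prod[OF B(1) C(1) B(2) C(2)]]
      U(2) m by (metis GG_simps(2))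
  obtain g h where gh: "\<forall>f\<in>F. g f \<in> B \<and> h f \<in> C \<and> (\<exists>s. g f * h f \<prec>[s] f)"
    using up_timesE[OF F(2)] .
  show "\<exists>V W. openin (gtop GG) V \<and> openin (gtop GG) W \<and> x \<in> V \<and> y \<in> W \<and>
      (\<forall>x' y'. (x', y') \<in> composable GG \<longrightarrow> x' \<in> V \<longrightarrow> y' \<in> W \<longrightarrow> gmult GG x' y' \<in> U)"
  proof (intro exI conjI allI impI)
    show "openin (gtop GG) (germ_nbhd b (g ` F))" "openin (gtop GG) (germ_nbhd c (h ` F))"
      using F(1) by (auto intro!: openin_germ_nbhd)
    show "x \<in> germ_nbhd b (g ` F)" "y \<in> germ_nbhd c (h ` F)"
      using germ_in_nbhd[OF B(1,2), of "g ` F"] germ_in_nbhd[OF C(1,2), of "h ` F"] gh B(3) C(3)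
      by auto
    fix x' y'
    assume "(x', y') \<in> composable GG" "x' \<in> germ_nbhd b (g ` F)" "y' \<in> germ_nbhd c (h ` F)"
    then obtain B' C' where B': "x' = germ N Z b B'" "B' \<in> cosets N Z" "b \<in> B'" "g ` F \<subseteq> B'"
      and C': "y' = germ N Z c C'" "C' \<in> cosets N Z" "c \<in> C'" "h ` F \<subseteq> C'"
      and BC': "src B' = rng C'"
      by (auto simp: germ_nbhd_def)
    have "F \<subseteq> (B' * C')\<^sup>\<up>"
    proof
      fix f assume f: "f \<in> F"
      then obtain s where "g f * h f \<prec>[s] f" using gh by blast
      with f B'(4) C'(4) show "f \<in> (B' * C')\<^sup>\<up>"
        using in_upI[OF set_times_intro, of "g f" B' "h f" C'] by blast
    qed
    then have "germ N Z (b * c) ((B' * C')\<^sup>\<up>) \<in> U"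
      using F(3) germ_in_nbhd[OF prod_in_cosets[OF B'(2) C'(2) BC'] in_prod[OF B'(2) C'(2) B'(3) C'(3)]]
      by blast
    then show "gmult GG x' y' \<in> U"
      using germ_mult_germ[OF B'(2) C'(2) BC' B'(3) C'(3)] B'(1) C'(1) by simp
  qed
qed


section \<open>The projection\<close>

lemma continuous_proj: "continuous_map (gtop GG) (gtop CG) germ_proj"
  unfolding continuous_map_def germ_proj_def
proof (intro conjI allI impI)
  show "snd \<in> topspace (gtop GG) \<rightarrow> topspace (gtop CG)"
    by (simp add: snd_in_cosets)
  fix U assume U: "openin (gtop CG) U"
  show "openin (gtop GG) {x \<in> topspace (gtop GG). snd x \<in> U}"
  proof (rule openin_GG_I)
    fix c C assume C: "C \<in> cosets N Z" and "c \<in> C"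
      and "germ N Z c C \<in> {x \<in> topspace (gtop GG). snd x \<in> U}"
    then have "C \<in> U" by simp
    then obtain F where F: "finite F" "F \<subseteq> C" "\<forall>D\<in>cosets N Z. F \<subseteq> D \<longrightarrow> D \<in> U"
      using openin_CG_D[OF U] by metis
    then have "germ_nbhd c F \<subseteq> {x \<in> topspace (gtop GG). snd x \<in> U}"
      by (auto simp: germ_nbhd_def germ_in_germs)
    with F(1,2) show "\<exists>F. finite F \<and> F \<subseteq> C \<and> germ_nbhd c F \<subseteq> {x \<in> topspace (gtop GG). snd x \<in> U}"
      by auto
  qed auto
qed

lemma open_proj: "open_map (gtop GG) (gtop CG) germ_proj"
  unfolding open_map_def germ_proj_def
proof (intro allI impI)
  fix U assume U: "openin (gtop GG) U"
  have sub: "U \<subseteq> germs N Z" using openin_subset[OF U] by simp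
  show "openin (gtop CG) (snd ` U)"
    unfolding openin_CG_iff
  proof (intro conjI ballI)
    show "snd ` U \<subseteq> cosets N Z" using sub snd_in_cosets by auto
    fix C assume "C \<in> snd ` U"
    then obtain x where x: "x \<in> U" "C = snd x" by auto
    obtain c D where c: "D \<in> cosets N Z" "c \<in> D" "x = germ N Z c D"
      using germsE[OF subsetD[OF sub x(1)]] .
    then have CD: "C = D" using x(2) by simp
    obtain F where F: "finite F" "F \<subseteq> D" "germ_nbhd c F \<subseteq> U"
      using openin_GG_D[OF U _ c(1,2)] x(1) c(3) by metis
    have "E \<in> snd ` U" if E: "E \<in> cosets N Z" "insert c F \<subseteq> E" for E
      using germ_in_nbhd[OF E(1), of c F] E(2) F(3) image_eqI[of E snd "germ N Z c E" U] E(1) by auto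
    then show "\<exists>F. finite F \<and> F \<subseteq> C \<and> (\<forall>D\<in>cosets N Z. F \<subseteq> D \<longrightarrow> D \<in> snd ` U)"
      using F c(2) CD by (intro exI[of _ "insert c F"]) simp
  qed
qed

lemma gsource_GG:
  assumes "x \<in> germs N Z"
  obtains c C d c' where "C \<in> cosets N Z" "d \<in> C" "d \<prec>[c'] c"
    "gsource GG x = germ N Z (c' * c) (src C)" "c' * c \<in> src C"
proof -
  obtain c C d c' where C: "C \<in> cosets N Z" "c \<in> C" "x = germ N Z c C" "d \<in> C" "d \<prec>[c'] c"
    "c' \<in> C\<^sup>\<star>" "germ_inv N Z x = germ N Z c' (C\<^sup>\<star>)"
    using germ_invE[OF assms] .
  have "gsource GG x = germ N Z (c' * c) (src C)"
    using germ_mult_germ[OF star_in_cosets[OF C(1)] C(1) src_star[OF cosetsD(1)[OF C(1)]] C(6,2)] C(3,7)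
    by (simp add: gsource_def src_eq)
  from that[OF C(1,4,5) this star_coset_mult(2)[OF C(1,2,6)]] show thesis .
qed

text \<open>A unit germ has a representative \<open>c' c\<close> that fixes \<open>c' d\<close>, where \<open>d \<prec>[c'] c\<close>.  Given a second one
  fixing \<open>e' f\<close>, the two agree after multiplying by \<open>c' d\<close> on the left and \<open>e' f\<close> on the right.\<close>

lemma inj_proj_units: "inj_on germ_proj (gunits GG)"
proof (rule inj_onI)
  fix x y assume x: "x \<in> gunits GG" and y: "y \<in> gunits GG" and eq: "germ_proj x = germ_proj y"
  obtain c C d c' where C: "C \<in> cosets N Z" "d \<in> C" "d \<prec>[c'] c"
    "x = germ N Z (c' * c) (src C)" "c' * c \<in> src C"
    using x gsource_GG by (auto simp: gunits_def) metis
  obtain e E f e' where E: "E \<in> cosets N Z" "f \<in> E" "f \<prec>[e'] e"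
    "y = germ N Z (e' * e) (src E)" "e' * e \<in> src E"
    using y gsource_GG by (auto simp: gunits_def) metis
  note S = src_in_cosets[OF C(1)] src_idem[OF C(1)]
  have CE: "src C = src E"
    using eq C(4) E(4) src_in_cosets[OF C(1)] src_in_cosets[OF E(1)] by (simp add: germ_proj_def)
  have p: "c' * d \<in> rng (src C)" and q: "e' * f \<in> src (src C)"
    using star_coset_mult(2)[OF C(1,2) in_starI[OF C(2,3)]]
      star_coset_mult(2)[OF E(1,2) in_starI[OF E(2,3)]] CE S by simp_all
  have "c' * d * (c' * c * (e' * f)) = c' * d * (e' * e * (e' * f))"
    by (simp add: mult.assoc viaD[OF C(3)] viaD[OF E(3)])
  then have "(c' * c, e' * e) \<in> germ_rel N Z (src C)"
    using germ_relI[OF S(1) C(5) _ p q] E(5) CE by simp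
  then show "x = y"
    using germ_eqI[OF S(1)] C(4) E(4) CE by simp
qed

lemma proj_functor: "groupoid_functor GG CG germ_proj"
  unfolding groupoid_functor_def germ_proj_def
proof (intro conjI allI impI)
  show "snd ` arrows GG \<subseteq> arrows CG"
    unfolding GG_simps CG_simps by (rule image_subsetI) (rule snd_in_cosets)
  fix x y assume xy: "(x, y) \<in> composable GG"
  then show "(snd x, snd y) \<in> composable CG"
    by (simp add: snd_in_cosets)
  show "snd (gmult GG x y) = gmult CG (snd x) (snd y)"
    using snd_mult[OF xy] by simp
qed

lemma proj_locally_injective:
  assumes "x \<in> arrows GG"
  shows "\<exists>U. openin (gtop GG) U \<and> x \<in> U \<and> inj_on germ_proj U"
proof -
  obtain c C where C: "C \<in> cosets N Z" "c \<in> C" "x = germ N Z c C"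
    using assms unfolding GG_simps by (rule germsE)
  have "inj_on germ_proj (germ_nbhd c {})"
  proof (rule inj_onI)
    fix y z assume "y \<in> germ_nbhd c {}" "z \<in> germ_nbhd c {}" and eq: "germ_proj y = germ_proj z"
    then obtain D E where "y = germ N Z c D" "D \<in> cosets N Z" "z = germ N Z c E" "E \<in> cosets N Z"
      by (auto simp: germ_nbhd_def)
    with eq show "y = z" by (simp add: germ_proj_def)
  qed
  moreover have "x \<in> germ_nbhd c {}"
    using germ_in_nbhd[OF C(1,2)] C(3) by simp
  ultimately show ?thesis
    using openin_germ_nbhd[of "{}" c] by auto
qed

lemma etale_bundle_proj: "etale_bundle GG CG germ_proj"
  unfolding etale_bundle_def groupoid_bundle_def topological_groupoid_def isocofibration_def
  using groupoid_GG continuous_germ_inv continuous_germ_mult etale_CG proj_functor inj_proj_units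
    continuous_proj open_proj proj_locally_injective
  by auto

end

theorem theorem9p2:
  fixes N Z :: "'a::semigroup_mult set"
  assumes "structured_semigroup N Z"
  shows "etale_bundle (germ_groupoid N Z) (coset_groupoid N Z) germ_proj"
proof -
  interpret structured N Z
    by (rule structured.intro) (rule assms)
  show ?thesis
    by (rule etale_bundle_proj)
qed

end
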